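(* Let $m$ be an even positive integer, let $\tilde H\in\Omega_{4n}$ be invertible and Hermitian, and let $\tilde B\in\Omega_{4n}$ be $\tilde H$-selfadjoint with $\sigma(\tilde B)\subset(-\infty,0)$. Then there exists an $\tilde H$-selfadjoint $\tilde A\in\Omega_{4n}$ with $\tilde A^m=\tilde B$ if and only if there exist an invertible $S\in\Omega_{4n}$, an integer $t$, integers $k_j\ge1$ and numbers $\lambda_j<0$ ($j=1,\dots,t$) such that $$S^{-1}\tilde BS=\bigoplus_{j=1}^t\big(J_{k_j}(\lambda_j)\oplus J_{k_j}(\lambda_j)\big)\oplus\bigoplus_{j=1}^t\big(J_{k_j}(\lambda_j)\oplus J_{k_j}(\lambda_j)\big),$$ $$S^*\tilde HS=\bigoplus_{j=1}^t\big(Q_{k_j}\oplus -Q_{k_j}\big)\oplus\bigoplus_{j=1}^t\big(Q_{k_j}\oplus -Q_{k_j}\big).$$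
   Context: $\Omega_{2k}=\{\begin{bmatrix}A_1&\bar A_2\\-A_2&\bar A_1\end{bmatrix}: A_1,A_2\in\mathbb{C}^{k\times k}\}\subset\mathbb{C}^{2k\times 2k}$. $J_k(\lambda)$: $k\times k$ upper triangular Jordan block with eigenvalue $\lambda$; $Q_k$: $k\times k$ matrix with ones on the main anti-diagonal and zeros elsewhere; $\oplus$: block diagonal sum. For invertible Hermitian $H$, $A$ is $H$-selfadjoint if $HA=A^*H$. *)

theory Defs
  imports "Jordan_Normal_Form.Jordan_Normal_Form" "Jordan_Normal_Form.Schur_Decomposition"
begin

text \<open>The set Omega_{2k} of complex 2k x 2k matrices of block form
  [A1, conj A2; -A2, conj A1] with A1, A2 complex k x k matrices.\<close>
definition Omega :: "nat \<Rightarrow> complex mat set" where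
  "Omega k = {four_block_mat A1 (map_mat cnj A2) (- A2) (map_mat cnj A1) | A1 A2.
                A1 \<in> carrier_mat k k \<and> A2 \<in> carrier_mat k k}"

definition Q_mat :: "nat \<Rightarrow> complex mat" where
  "Q_mat k = mat k k (\<lambda>(i,j). if i + j = k - 1 then 1 else 0)"

definition hermitian_mat :: "complex mat \<Rightarrow> bool" where
  "hermitian_mat H \<longleftrightarrow> square_mat H \<and> mat_adjoint H = H"

definition H_selfadjoint :: "complex mat \<Rightarrow> complex mat \<Rightarrow> bool" where
  "H_selfadjoint H A \<longleftrightarrow> H * A = mat_adjoint A * H"

definition spectrum_mat :: "complex mat \<Rightarrow> complex set" where
  "spectrum_mat A = {e. eigenvalue A e}"

definition inv_mat :: "complex mat \<Rightarrow> complex mat" where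
  "inv_mat S = (THE T. inverts_mat S T \<and> inverts_mat T S)"

definition jordan_part :: "(nat \<times> real) list \<Rightarrow> complex mat list" where
  "jordan_part ps = concat (map (\<lambda>(k,l). [jordan_block k (complex_of_real l),
                                           jordan_block k (complex_of_real l)]) ps)"

definition Q_part :: "(nat \<times> real) list \<Rightarrow> complex mat list" where
  "Q_part ps = concat (map (\<lambda>(k,l). [Q_mat k, - Q_mat k]) ps)"

end

theory Submission
  imports Defs
begin

text \<open>
  Both sides are equivalent to the existence of a selfadjoint K in Omega that commutes with B and
  satisfies K^2 = -1. Since the spectrum of B is negative, -B has for every m an m-th root p(B) with a
  real polynomial p. From a root A of B one gets K = A^(m/2) M^(-1), where M is such a square root
  of -B; conversely (cos(pi/m) + sin(pi/m) K) p(B) is an m-th root of B. For the canonical form, K is the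
  rotation of the two Jordan blocks of each pair.

  Given K, let J be the quaternionic structure. The eigenspace V+ of K for the eigenvalue i is isotropic,
  and [Jx, y] is a symplectic form on it for which B is selfadjoint; hence Jordan chains of B in V+ are
  isotropic and come in dual pairs e, f. The chains of e - Jf/2 and e + Jf/2 then have the Gram matrices Q
  and -Q. A maximal family of such pairs exhausts the space, because its orthogonal complement
  is again invariant under B, K and J.
\<close>

section \<open>Real polynomial roots of -x\<close>

text \<open>The polynomials have to be real: the quaternionic structure is antilinear, so real
  polynomials in B stay in Omega while multiplication by i leaves it. A root A yields the square
  root A^(m/2) of B, whereas -B already has a square root that is a polynomial in B; what A adds is
  the quotient of the two, and that is K up to sign. Since K is selfadjoint and i is not real, an
  eigenvector of K for i is orthogonal to all eigenvectors for i, itself included. This forces the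
  signs of the Jordan blocks to cancel: a chain in V+ needs a partner in J V+, and an orthogonal
  basis of such a hyperbolic pair has one sign +1 and one sign -1. The factor 1/2 is a
  normalization: pairing e + a Jf with itself along the chain gives -2a, so a = -1/2 and a = 1/2
  produce the signs 1 and -1. The images of both chains under J account for the second copy of the
  list in the canonical form.\<close>

lemma real_poly_root_mod_linear_prod:
  assumes "m > 0" and "\<forall>l \<in> set ls. l < 0"
  shows "\<exists>p :: real poly. (\<Prod>l\<leftarrow>ls. [:- l, 1:]) dvd p ^ m + [:0, 1:]"
  using assms(2)
proof (induction ls)
  case Nil
  then show ?case by simp
next
  case (Cons l ls)
  then obtain p :: "real poly" where p: "(\<Prod>l\<leftarrow>ls. [:- l, 1:]) dvd p ^ m + [:0, 1:]" by auto
  define q where "q = (\<Prod>l\<leftarrow>ls. [:- l, 1:])"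
  obtain h where h: "p ^ m + [:0, 1:] = q * h" using p unfolding q_def by (auto elim: dvdE)
  show ?case
  proof (cases "poly q l = 0")
    case False
    \<comment> \<open>For a new root \<open>l\<close> this is interpolation: adding a multiple of
      \<open>q\<close> keeps the congruence modulo \<open>q\<close>, and \<open>c\<close> moves the
      value at \<open>l\<close> to the real root of the positive number \<open>- l\<close>.\<close>
    define c where "c = (root m (- l) - poly p l) / poly q l"
    define p' where "p' = p + Polynomial.smult c q"
    have "poly p' l = root m (- l)" using False by (simp add: p'_def c_def)
    hence 1: "poly (p' ^ m + [:0, 1:]) l = 0"
      using Cons.prems assms(1) by (simp add: poly_power)
    have "q dvd p' - p" by (simp add: p'_def dvd_smult)
    moreover have "p' - p dvd p' ^ m - p ^ m"
      unfolding power_diff_sumr2 by (rule dvd_triv_left)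
    ultimately have "q dvd p' ^ m - p ^ m" by (rule dvd_trans)
    moreover have "q dvd p ^ m + [:0, 1:]" unfolding h by simp
    ultimately have "q dvd (p' ^ m - p ^ m) + (p ^ m + [:0, 1:])" by (rule dvd_add)
    moreover have "(p' ^ m - p ^ m) + (p ^ m + [:0, 1:]) = p' ^ m + [:0, 1:]"
      by (simp only: add.assoc[symmetric] diff_add_cancel)
    ultimately have "q dvd p' ^ m + [:0, 1:]" by (simp only:)
    then obtain h' where h': "p' ^ m + [:0, 1:] = q * h'" by (elim dvdE)
    have "poly h' l = 0" using 1 False unfolding h' by simp
    hence "[:- l, 1:] dvd h'" unfolding poly_eq_0_iff_dvd .
    hence "q * [:- l, 1:] dvd p' ^ m + [:0, 1:]" unfolding h' by (rule mult_dvd_mono[OF dvd_refl])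
    hence "(\<Prod>l\<leftarrow>l # ls. [:- l, 1:]) dvd p' ^ m + [:0, 1:]"
      unfolding q_def by (simp only: list.map prod_list.Cons mult.commute)
    thus ?thesis by blast
  next
    case True
    have "poly (p ^ m + [:0, 1:]) l = 0" unfolding h using True by simp
    hence "poly p l ^ m = - l" by (simp add: poly_power)
    hence pl: "poly p l \<noteq> 0" using Cons.prems assms(1) by (auto simp: zero_power)
    \<comment> \<open>For a repeated root this is a Hensel step. The quotient by \<open>q\<close>
      changes from \<open>h\<close> to \<open>h + c g\<close>, where \<open>g\<close> takes the
      value \<open>m * p(l)^(m-1)\<close> at \<open>l\<close>; this derivative is nonzero because
      \<open>p(l)^m = - l\<close>, and \<open>c\<close> makes the new quotient vanish at
      \<open>l\<close>.\<close>
    define c where "c = - poly h l / (real m * poly p l ^ (m - 1))"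
    define p' where "p' = p + Polynomial.smult c q"
    define g where "g = (\<Sum>i<m. p ^ (m - Suc i) * p' ^ i)"
    have "p' ^ m - p ^ m = Polynomial.smult c q * g"
      unfolding g_def by (subst power_diff_sumr2) (simp only: p'_def add_diff_cancel_left')
    hence "p' ^ m + [:0, 1:] = Polynomial.smult c q * g + (p ^ m + [:0, 1:])"
      by (simp only: diff_eq_eq add.assoc)
    hence e: "p' ^ m + [:0, 1:] = q * (h + Polynomial.smult c g)"
      unfolding h by (simp only: distrib_left mult_smult_left mult_smult_right add.commute)
    have "poly p' l = poly p l" using True by (simp add: p'_def)
    hence "poly g l = (\<Sum>i<m. poly p l ^ (m - 1))"
      unfolding g_def poly_sum by (intro sum.cong) (auto simp: poly_power power_add[symmetric])
    hence "poly (h + Polynomial.smult c g) l = 0" using pl assms(1) by (simp add: c_def)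
    hence "[:- l, 1:] dvd h + Polynomial.smult c g" unfolding poly_eq_0_iff_dvd .
    hence "q * [:- l, 1:] dvd p' ^ m + [:0, 1:]" unfolding e by (rule mult_dvd_mono[OF dvd_refl])
    hence "(\<Prod>l\<leftarrow>l # ls. [:- l, 1:]) dvd p' ^ m + [:0, 1:]"
      unfolding q_def by (simp only: list.map prod_list.Cons mult.commute)
    thus ?thesis by blast
  qed
qed

text \<open>If \<open>q\<close> is \<open>a + X * q'\<close> with \<open>a\<close> nonzero, then
  \<open>- q' / a\<close> inverts X modulo \<open>q\<close>. The inverse of \<open>B\<close> thereby
  becomes a real polynomial in \<open>B\<close> and inherits selfadjointness and membership in
  \<open>Omega\<close>.\<close>

lemma poly_inverse_X_mod:
  fixes q :: "real poly"
  assumes "poly q 0 \<noteq> 0"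
  shows "\<exists>w. q dvd [:0, 1:] * w - 1"
proof (cases q)
  case (pCons a q')
  have a: "a \<noteq> 0" using assms pCons by simp
  have "[:0, 1:] * Polynomial.smult (- 1 / a) q' - 1 = Polynomial.smult (- 1 / a) q"
    using a by (simp add: pCons one_pCons)
  thus ?thesis by (metis dvd_refl dvd_smult)
qed

section \<open>Adjoints and the quaternionic structure\<close>

interpretation cnj_hom: comm_ring_hom cnj
  by unfold_locales auto

lemma mat_adjoint_dim [simp]: "dim_row (mat_adjoint A) = dim_col A" "dim_col (mat_adjoint A) = dim_row A"
  by (simp_all add: mat_adjoint_def)

lemma mat_adjoint_carrier [simp]: "A \<in> carrier_mat r c \<Longrightarrow> mat_adjoint A \<in> carrier_mat c r"
  by (intro carrier_matI) simp_all

lemma index_mat_adjoint [simp]: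
  "i < dim_col A \<Longrightarrow> j < dim_row A \<Longrightarrow> mat_adjoint A $$ (i, j) = cnj (A $$ (j, i))"
  for A :: "complex mat"
  by (simp add: mat_adjoint_def mat_of_rows_index)

lemma mat_adjoint_conv_transpose: "mat_adjoint A = transpose_mat (map_mat cnj A)"
  by (rule eq_matI) auto

lemma mat_adjoint_mult:
  assumes "A \<in> carrier_mat r k" "B \<in> carrier_mat k c"
  shows "mat_adjoint (A * B) = mat_adjoint B * mat_adjoint (A :: complex mat)"
  unfolding mat_adjoint_conv_transpose cnj_hom.mat_hom_mult[OF assms]
  by (rule transpose_mult[of _ r k _ c]) (use assms in auto)

lemma conjugate_mult_mat_vec:
  assumes "A \<in> carrier_mat r c" "x \<in> carrier_vec c"
  shows "conjugate (A *\<^sub>v x) = map_mat cnj A *\<^sub>v conjugate (x :: complex vec)"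
proof (rule eq_vecI)
  fix i assume "i < dim_vec (map_mat cnj A *\<^sub>v conjugate x)"
  hence "i < r" using assms by auto
  thus "conjugate (A *\<^sub>v x) $ i = (map_mat cnj A *\<^sub>v conjugate x) $ i"
    using assms by (simp add: scalar_prod_def)
qed auto

lemma cscalar_prod_mat_adjoint:
  assumes "A \<in> carrier_mat r c" "x \<in> carrier_vec c" "y \<in> carrier_vec r"
  shows "y \<bullet>c (A *\<^sub>v x) = (mat_adjoint A *\<^sub>v y) \<bullet>c (x :: complex vec)"
  unfolding mat_adjoint_conv_transpose conjugate_mult_mat_vec[OF assms(1,2)]
  by (rule transpose_vec_mult_scalar[symmetric]) (use assms in auto)

text \<open>The antilinear map x \<mapsto> quat_mat N (cnj x) is the action of the quaternion unit j, and Omega N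
  consists of the matrices commuting with it.\<close>

definition quat_mat :: "nat \<Rightarrow> complex mat" where
  "quat_mat N = four_block_mat (0\<^sub>m N N) (- 1\<^sub>m N) (1\<^sub>m N) (0\<^sub>m N N)"

lemma quat_mat_carrier [simp]: "quat_mat N \<in> carrier_mat (N + N) (N + N)"
  unfolding quat_mat_def by auto

lemma quat_mat_dim [simp]: "dim_row (quat_mat N) = N + N" "dim_col (quat_mat N) = N + N"
  unfolding quat_mat_def by auto

lemma quat_mat_square: "quat_mat N * quat_mat N = - 1\<^sub>m (N + N)"
proof -
  have "quat_mat N * quat_mat N = four_block_mat (- 1\<^sub>m N) (0\<^sub>m N N) (0\<^sub>m N N) (- 1\<^sub>m N)"
    unfolding quat_mat_def
    by (subst mult_four_block_mat[of _ N N _ N _ N _ _ N _ N]) auto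
  also have "\<dots> = - 1\<^sub>m (N + N)" by (rule eq_matI) auto
  finally show ?thesis .
qed

lemma quat_mat_adjoint: "mat_adjoint (quat_mat N) = - quat_mat N"
  unfolding quat_mat_def by (rule eq_matI) auto

lemma quat_mat_cnj: "map_mat cnj (quat_mat N) = quat_mat N"
  unfolding quat_mat_def by (rule eq_matI) auto

text \<open>A single matrix equation replaces the block shape; the closure of \<open>Omega\<close>
  under products, sums, real multiples and inverses then needs no blocks.\<close>

lemma Omega_iff:
  "M \<in> Omega N \<longleftrightarrow> M \<in> carrier_mat (N + N) (N + N) \<and> M * quat_mat N = quat_mat N * map_mat cnj M"
proof
  assume "M \<in> Omega N"
  then obtain A1 A2 where M: "M = four_block_mat A1 (map_mat cnj A2) (- A2) (map_mat cnj A1)"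
    and c: "A1 \<in> carrier_mat N N" "A2 \<in> carrier_mat N N" unfolding Omega_def by auto
  have cM: "map_mat cnj M = four_block_mat (map_mat cnj A1) A2 (map_mat cnj (- A2)) A1"
    unfolding M using c by (intro eq_matI) auto
  have 1: "M * quat_mat N = four_block_mat (map_mat cnj A2) (- A1) (map_mat cnj A1) A2"
    unfolding M quat_mat_def using c
    by (subst mult_four_block_mat[of _ N N _ N _ N _ _ N _ N]) auto
  have 2: "quat_mat N * map_mat cnj M = four_block_mat (map_mat cnj A2) (- A1) (map_mat cnj A1) A2"
    unfolding cM quat_mat_def using c
    by (subst mult_four_block_mat[of _ N N _ N _ N _ _ N _ N]) (auto intro!: cong_four_block_mat)
  show "M \<in> carrier_mat (N + N) (N + N) \<and> M * quat_mat N = quat_mat N * map_mat cnj M"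
    using 1 2 M c by auto
next
  assume *: "M \<in> carrier_mat (N + N) (N + N) \<and> M * quat_mat N = quat_mat N * map_mat cnj M"
  obtain A B C D where "split_block M N N = (A, B, C, D)" by (metis prod_cases4)
  from split_block[OF this] * have c: "A \<in> carrier_mat N N" "B \<in> carrier_mat N N"
    "C \<in> carrier_mat N N" "D \<in> carrier_mat N N" and M: "M = four_block_mat A B C D" by auto
  have cM: "map_mat cnj M = four_block_mat (map_mat cnj A) (map_mat cnj B) (map_mat cnj C) (map_mat cnj D)"
    unfolding M using c by (intro eq_matI) auto
  have 1: "M * quat_mat N = four_block_mat B (- A) D (- C)"
    unfolding M quat_mat_def using c
    by (subst mult_four_block_mat[of _ N N _ N _ N _ _ N _ N]) auto
  have 2: "quat_mat N * map_mat cnj M = four_block_mat (- map_mat cnj C) (- map_mat cnj D) (map_mat cnj A) (map_mat cnj B)"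
    unfolding cM quat_mat_def using c
    by (subst mult_four_block_mat[of _ N N _ N _ N _ _ N _ N]) auto
  have eq: "four_block_mat B (- A) D (- C) =
      four_block_mat (- map_mat cnj C) (- map_mat cnj D) (map_mat cnj A) (map_mat cnj B)"
    using * 1 2 by simp
  \<comment> \<open>The two left blocks of \<open>eq\<close> determine \<open>B\<close> and
    \<open>D\<close>; the two right blocks repeat the same conditions. The witness for
    \<open>A2\<close> is therefore \<open>- C\<close>.\<close>
  have "B = map_mat cnj (- C)"
  proof (rule eq_matI)
    fix i j assume "i < dim_row (map_mat cnj (- C))" "j < dim_col (map_mat cnj (- C))"
    thus "B $$ (i, j) = map_mat cnj (- C) $$ (i, j)"
      using arg_cong[OF eq, of "\<lambda>M. M $$ (i, j)"] c by simp
  qed (use c in auto)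
  moreover have "D = map_mat cnj A"
  proof (rule eq_matI)
    fix i j assume "i < dim_row (map_mat cnj A)" "j < dim_col (map_mat cnj A)"
    thus "D $$ (i, j) = map_mat cnj A $$ (i, j)"
      using arg_cong[OF eq, of "\<lambda>M. M $$ (i + N, j)"] c by simp
  qed (use c in auto)
  ultimately have "M = four_block_mat A (map_mat cnj (- C)) (- (- C)) (map_mat cnj A)"
    using M by simp
  moreover have "- C \<in> carrier_mat N N" using c by simp
  ultimately show "M \<in> Omega N" unfolding Omega_def using c(1) by blast
qed

lemma Omega_carrier: "M \<in> Omega N \<Longrightarrow> M \<in> carrier_mat (N + N) (N + N)"
  by (simp add: Omega_iff)

lemma Omega_one [simp]: "1\<^sub>m (N + N) \<in> Omega N"
  by (simp add: Omega_iff cnj_hom.mat_hom_one)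

lemma Omega_zero [simp]: "0\<^sub>m (N + N) (N + N) \<in> Omega N"
proof -
  have "map_mat cnj (0\<^sub>m (N + N) (N + N)) = 0\<^sub>m (N + N) (N + N)" by (rule eq_matI) auto
  thus ?thesis by (simp add: Omega_iff)
qed

lemma Omega_mult:
  assumes "A \<in> Omega N" "B \<in> Omega N"
  shows "A * B \<in> Omega N"
proof -
  let ?d = "N + N" and ?P = "quat_mat N"
  note c [simp] = assms[THEN Omega_carrier] quat_mat_carrier[of N]
  have a: "A * ?P = ?P * map_mat cnj A" "B * ?P = ?P * map_mat cnj B"
    using assms by (auto simp: Omega_iff)
  have "A * B * ?P = A * (B * ?P)"
    by (rule assoc_mult_mat[of _ ?d ?d _ ?d _ ?d]) auto
  also have "\<dots> = A * ?P * map_mat cnj B"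
    unfolding a(2) by (rule assoc_mult_mat[symmetric, of _ ?d ?d _ ?d _ ?d]) auto
  also have "\<dots> = ?P * (map_mat cnj A * map_mat cnj B)"
    unfolding a(1) by (rule assoc_mult_mat[of _ ?d ?d _ ?d _ ?d]) auto
  also have "\<dots> = ?P * map_mat cnj (A * B)"
    by (simp add: cnj_hom.mat_hom_mult[of _ ?d ?d _ ?d])
  finally show ?thesis using mult_carrier_mat[OF c(1,2)] by (simp add: Omega_iff)
qed

lemma Omega_add:
  assumes "A \<in> Omega N" "B \<in> Omega N"
  shows "A + B \<in> Omega N"
proof -
  let ?d = "N + N"
  note c [simp] = assms[THEN Omega_carrier] quat_mat_carrier[of N]
  have "map_mat cnj (A + B) = map_mat cnj A + map_mat cnj B"
    
  proof (rule eq_matI)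
    fix i j assume "i < dim_row (map_mat cnj A + map_mat cnj B)" "j < dim_col (map_mat cnj A + map_mat cnj B)"
    thus "map_mat cnj (A + B) $$ (i, j) = (map_mat cnj A + map_mat cnj B) $$ (i, j)"
      using c(1)[THEN carrier_matD(1)] c(1)[THEN carrier_matD(2)] c(2)[THEN carrier_matD(1)] c(2)[THEN carrier_matD(2)] by simp
  qed auto
  thus ?thesis using assms
    by (simp add: Omega_iff add_mult_distrib_mat[of _ ?d ?d _ _ ?d] mult_add_distrib_mat[of _ ?d ?d _ ?d])
qed

text \<open>Real scalars pass through the conjugation in the quaternionic structure. This is the
  source of the restriction to real polynomials.\<close>

lemma Omega_smult:
  assumes "A \<in> Omega N"
  shows "complex_of_real a \<cdot>\<^sub>m A \<in> Omega N"
proof -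
  let ?d = "N + N"
  note c [simp] = assms[THEN Omega_carrier] quat_mat_carrier[of N]
  have "map_mat cnj (complex_of_real a \<cdot>\<^sub>m A) = complex_of_real a \<cdot>\<^sub>m map_mat cnj A"
    by (intro eq_matI) auto
  thus ?thesis using assms
    by (simp add: Omega_iff mult_smult_distrib[of _ ?d ?d _ ?d] mult_smult_assoc_mat[of _ ?d ?d _ ?d])
qed

text \<open>Conjugating \<open>S * T\<close> shows that the conjugates of \<open>S\<close> and
  \<open>T\<close> are inverse as well. Their product is inserted behind
  \<open>T * quat_mat N\<close>, the conjugate of \<open>S\<close> moves to the left through
  \<open>quat_mat N\<close>, and \<open>T * S\<close> cancels.\<close>

lemma Omega_inverse:
  assumes S: "S \<in> Omega N" and T: "T \<in> carrier_mat (N + N) (N + N)"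
    and ST: "S * T = 1\<^sub>m (N + N)" "T * S = 1\<^sub>m (N + N)"
  shows "T \<in> Omega N"
proof -
  let ?d = "N + N" and ?P = "quat_mat N" and ?c = "map_mat cnj"
  note c [simp] = S[THEN Omega_carrier] quat_mat_carrier[of N] T
  have "?c S * ?c T = 1\<^sub>m ?d"
    using ST(1) cnj_hom.mat_hom_mult[of S ?d ?d T ?d] by (simp add: cnj_hom.mat_hom_one)
  hence "T * ?P = T * (?P * (?c S * ?c T))"
    by (simp add: right_mult_one_mat[of _ ?d ?d])
  also have "\<dots> = T * ((?P * ?c S) * ?c T)"
    by (subst assoc_mult_mat[of _ ?d ?d _ ?d _ ?d]) auto
  also have "?P * ?c S = S * ?P" using S by (simp add: Omega_iff)
  also have "T * (S * ?P * ?c T) = (T * S) * (?P * ?c T)"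
    by (simp add: assoc_mult_mat[of T ?d ?d S ?d "?P * ?c T" ?d] assoc_mult_mat[of S ?d ?d ?P ?d "?c T" ?d]
      mult_carrier_mat[of _ ?d ?d _ ?d])
  also have "\<dots> = ?P * ?c T" unfolding ST by simp
  finally show ?thesis using T by (simp add: Omega_iff)
qed

section \<open>Real polynomials in a matrix\<close>

text \<open>Horner's scheme, chosen so that its recursion follows \<open>pCons\<close> and each
  property of polynomials in a matrix is an induction over the polynomial.\<close>

definition poly_mat :: "complex mat \<Rightarrow> real poly \<Rightarrow> complex mat" where
  "poly_mat B p = fold_coeffs (\<lambda>a M. complex_of_real a \<cdot>\<^sub>m 1\<^sub>m (dim_row B) + B * M) p
     (0\<^sub>m (dim_row B) (dim_row B))"

lemma poly_mat_0 [simp]: "poly_mat B 0 = 0\<^sub>m (dim_row B) (dim_row B)"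
  by (simp add: poly_mat_def)

lemma poly_mat_pCons:
  assumes B: "B \<in> carrier_mat d d"
  shows "poly_mat B (pCons a p) = complex_of_real a \<cdot>\<^sub>m 1\<^sub>m d + B * poly_mat B p"
proof (cases "a = 0 \<and> p = 0")
  \<comment> \<open>The coefficient list of the zero polynomial is empty, so the fold makes no
    Horner step here.\<close>
  case True
  have "complex_of_real 0 \<cdot>\<^sub>m 1\<^sub>m d + B * 0\<^sub>m d d = 0\<^sub>m d d"
    using B by (intro eq_matI) auto
  thus ?thesis using True B by simp
next
  case False
  hence "coeffs (pCons a p) = a # coeffs p" by (auto simp: cCons_def)
  thus ?thesis using B by (simp add: poly_mat_def fold_coeffs_def)
qed

lemma poly_mat_carrier [simp]: "B \<in> carrier_mat d d \<Longrightarrow> poly_mat B p \<in> carrier_mat d d"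
proof (induction p)
  case (pCons a p)
  thus ?case by (simp add: poly_mat_pCons mult_carrier_mat[of _ d d])
qed (auto intro: carrier_matI)

lemma poly_mat_dim [simp]:
  "B \<in> carrier_mat d d \<Longrightarrow> dim_row (poly_mat B p) = d" "B \<in> carrier_mat d d \<Longrightarrow> dim_col (poly_mat B p) = d"
  using poly_mat_carrier[of B d p] by blast+

lemma mat_add_swap:
  fixes X :: "'a :: comm_ring mat"
  assumes "X \<in> carrier_mat r c" "Y \<in> carrier_mat r c" "Z \<in> carrier_mat r c" "W \<in> carrier_mat r c"
  shows "(X + Y) + (Z + W) = (X + Z) + (Y + W)"
  using assms by (intro eq_matI) auto

lemma poly_mat_add:
  assumes B: "B \<in> carrier_mat d d"
  shows "poly_mat B (p + q) = poly_mat B p + poly_mat B q"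
proof (induction p arbitrary: q)
  case 0
  show ?case using B poly_mat_carrier[OF B, of q] by simp
next
  case (pCons a p)
  obtain b q' where q: "q = pCons b q'" by (cases q)
  note c = poly_mat_carrier[OF B]
  have 1: "complex_of_real (a + b) \<cdot>\<^sub>m 1\<^sub>m d = complex_of_real a \<cdot>\<^sub>m 1\<^sub>m d + complex_of_real b \<cdot>\<^sub>m 1\<^sub>m d"
    by (intro eq_matI) auto
  have "poly_mat B (pCons a p + q) = complex_of_real (a + b) \<cdot>\<^sub>m 1\<^sub>m d + B * (poly_mat B p + poly_mat B q')"
    by (simp add: q poly_mat_pCons[OF B] pCons.IH)
  also have "\<dots> = (complex_of_real a \<cdot>\<^sub>m 1\<^sub>m d + complex_of_real b \<cdot>\<^sub>m 1\<^sub>m d) + (B * poly_mat B p + B * poly_mat B q')"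
    unfolding 1 mult_add_distrib_mat[OF B c c] ..
  also have "\<dots> = poly_mat B (pCons a p) + poly_mat B q"
    unfolding q poly_mat_pCons[OF B]
    by (rule mat_add_swap[of _ d d]) (use B c in auto)
  finally show ?case .
qed

lemma poly_mat_smult:
  assumes B: "B \<in> carrier_mat d d"
  shows "poly_mat B (Polynomial.smult a p) = complex_of_real a \<cdot>\<^sub>m poly_mat B p"
proof (induction p)
  case 0
  show ?case by simp
next
  case (pCons b p)
  note c = poly_mat_carrier[OF B]
  have cc: "B * poly_mat B p \<in> carrier_mat d d" using B c by (rule mult_carrier_mat)
  have "poly_mat B (Polynomial.smult a (pCons b p)) =
      complex_of_real (a * b) \<cdot>\<^sub>m 1\<^sub>m d + B * (complex_of_real a \<cdot>\<^sub>m poly_mat B p)"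
    by (simp add: poly_mat_pCons[OF B] pCons.IH)
  also have "\<dots> = complex_of_real (a * b) \<cdot>\<^sub>m 1\<^sub>m d + complex_of_real a \<cdot>\<^sub>m (B * poly_mat B p)"
    by (simp only: mult_smult_distrib[OF B c])
  also have "\<dots> = complex_of_real a \<cdot>\<^sub>m poly_mat B (pCons b p)"
    unfolding poly_mat_pCons[OF B] using carrier_matD[OF cc] by (intro eq_matI) (auto simp: algebra_simps simp del: index_mult_mat)
  finally show ?case .
qed

lemma poly_mat_mult:
  assumes B: "B \<in> carrier_mat d d"
  shows "poly_mat B (p * q) = poly_mat B p * poly_mat B q"
proof (induction p)
  case 0
  show ?case using B poly_mat_carrier[OF B, of q] by simp
next
  case (pCons a p)
  note c = poly_mat_carrier[OF B]
  have z: "complex_of_real 0 \<cdot>\<^sub>m 1\<^sub>m d + B * (poly_mat B p * poly_mat B q) = B * (poly_mat B p * poly_mat B q)"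
    using B c mult_carrier_mat[OF B mult_carrier_mat[OF c c]] by (intro eq_matI) auto
  have "poly_mat B (pCons a p * q) = complex_of_real a \<cdot>\<^sub>m poly_mat B q + B * (poly_mat B p * poly_mat B q)"
    by (simp only: mult_pCons_left poly_mat_add[OF B] poly_mat_smult[OF B] poly_mat_pCons[OF B] pCons.IH z)
  also have "\<dots> = (complex_of_real a \<cdot>\<^sub>m 1\<^sub>m d) * poly_mat B q + (B * poly_mat B p) * poly_mat B q"
    by (simp only: mult_smult_assoc_mat[OF one_carrier_mat c] left_mult_one_mat[OF c] assoc_mult_mat[OF B c c])
  also have "\<dots> = poly_mat B (pCons a p) * poly_mat B q"
    unfolding poly_mat_pCons[OF B]
    by (rule add_mult_distrib_mat[symmetric, of _ d d _ _ d]) (use B c mult_carrier_mat[OF B c] in auto)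
  finally show ?case .
qed

lemma poly_mat_1 [simp]: "B \<in> carrier_mat d d \<Longrightarrow> poly_mat B 1 = 1\<^sub>m d"
  by (subst one_pCons, subst poly_mat_pCons[of B d]) (auto intro!: eq_matI)

lemma poly_mat_X: "B \<in> carrier_mat d d \<Longrightarrow> poly_mat B [:0, 1:] = B"
  using poly_mat_1[of B d]
  by (subst poly_mat_pCons[of B d]) (auto simp: one_pCons intro!: eq_matI)

lemma poly_mat_linear:
  "B \<in> carrier_mat d d \<Longrightarrow> poly_mat B [:- l, 1:] = B + complex_of_real (- l) \<cdot>\<^sub>m 1\<^sub>m d"
  using poly_mat_1[of B d]
  by (subst poly_mat_pCons[of B d]) (auto simp: one_pCons intro!: eq_matI)

lemma poly_mat_power: "B \<in> carrier_mat d d \<Longrightarrow> poly_mat B (p ^ k) = poly_mat B p ^\<^sub>m k"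
proof (induction k)
  case 0
  thus ?case using poly_mat_carrier[of B d p] by simp
next
  case (Suc k)
  thus ?case by (simp add: poly_mat_mult[of B d] mult.commute[of p])
qed

lemma poly_mat_commute:
  assumes B: "B \<in> carrier_mat d d" and X: "X \<in> carrier_mat d d" and XB: "X * B = B * X"
  shows "X * poly_mat B p = poly_mat B p * X"
proof (induction p)
  case 0
  show ?case using B X by simp
next
  case (pCons a p)
  note c = poly_mat_carrier[OF B]
  have "X * poly_mat B (pCons a p) = complex_of_real a \<cdot>\<^sub>m X + X * (B * poly_mat B p)"
    unfolding poly_mat_pCons[OF B] using X B c mult_carrier_mat[OF B c]
    by (subst mult_add_distrib_mat[of _ d d _ d]) (auto simp: mult_smult_distrib[OF X one_carrier_mat])
  also have "X * (B * poly_mat B p) = (B * poly_mat B p) * X"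
    by (simp only: assoc_mult_mat[OF X B c, symmetric] XB assoc_mult_mat[OF B X c] pCons.IH
        assoc_mult_mat[OF B c X])
  also have "complex_of_real a \<cdot>\<^sub>m X + (B * poly_mat B p) * X = poly_mat B (pCons a p) * X"
    unfolding poly_mat_pCons[OF B] using X B c mult_carrier_mat[OF B c]
    by (subst add_mult_distrib_mat[of _ d d _ _ d]) (auto simp: mult_smult_assoc_mat[OF one_carrier_mat X])
  finally show ?case .
qed

lemma poly_mat_dvd_zero:
  assumes "B \<in> carrier_mat d d" "poly_mat B q = 0\<^sub>m d d" "q dvd p"
  shows "poly_mat B p = 0\<^sub>m d d"
proof -
  from assms(3) obtain r where "p = q * r" by (elim dvdE)
  thus ?thesis using assms poly_mat_carrier[OF assms(1), of r] by (simp add: poly_mat_mult[of B d])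
qed

lemma poly_mat_similar:
  assumes c: "B \<in> carrier_mat d d" "T \<in> carrier_mat d d" "P \<in> carrier_mat d d" "Q \<in> carrier_mat d d"
    and PQ: "P * Q = 1\<^sub>m d" "Q * P = 1\<^sub>m d" and B: "B = P * T * Q"
  shows "poly_mat B p = P * poly_mat T p * Q"
proof (induction p)
  case 0
  show ?case using c by simp
next
  case (pCons a p)
  let ?X = "poly_mat T p"
  note X = poly_mat_carrier[OF c(2), of p]
  note m = mult_carrier_mat
  have "B * (P * ?X * Q) = P * (T * ?X) * Q"
  proof -
    have "B * (P * ?X * Q) = P * T * (Q * (P * (?X * Q)))"
      unfolding B by (simp only: assoc_mult_mat[OF c(3) X c(4)] assoc_mult_mat[OF m[OF c(3,2)] c(4) m[OF c(3) m[OF X c(4)]]])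
    also have "Q * (P * (?X * Q)) = ?X * Q"
      by (simp only: assoc_mult_mat[OF c(4,3) m[OF X c(4)], symmetric] PQ left_mult_one_mat[OF m[OF X c(4)]])
    also have "P * T * (?X * Q) = P * (T * ?X) * Q"
      by (simp only: assoc_mult_mat[OF c(3,2) m[OF X c(4)]] assoc_mult_mat[OF c(2) X c(4)] 
        assoc_mult_mat[OF c(3) m[OF c(2) X] c(4)])
    finally show ?thesis .
  qed
  hence "poly_mat B (pCons a p) = complex_of_real a \<cdot>\<^sub>m 1\<^sub>m d + P * (T * ?X) * Q"
    by (simp only: poly_mat_pCons[OF c(1)] pCons.IH)
  also have "\<dots> = P * (complex_of_real a \<cdot>\<^sub>m 1\<^sub>m d) * Q + P * (T * ?X) * Q"
    using PQ by (simp only: mult_smult_distrib[OF c(3) one_carrier_mat] right_mult_one_mat[OF c(3)]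
       mult_smult_assoc_mat[OF c(3,4)])
  also have "\<dots> = (P * (complex_of_real a \<cdot>\<^sub>m 1\<^sub>m d) + P * (T * ?X)) * Q"
    by (rule add_mult_distrib_mat[symmetric, of _ d d _ _ d]) (use c X m[OF c(3) m[OF c(2) X]] in auto)
  also have "P * (complex_of_real a \<cdot>\<^sub>m 1\<^sub>m d) + P * (T * ?X) = P * poly_mat T (pCons a p)"
    unfolding poly_mat_pCons[OF c(2)]
    by (rule mult_add_distrib_mat[symmetric, of _ d d _ d]) (use c X m[OF c(2) X] in auto)
  finally show ?case .
qed

text \<open>The linear factors are multiplied in the order of the diagonal, so that each of them
  kills one more row, starting with the last one.\<close>

lemma upper_triangular_annihilated:
  assumes T: "T \<in> carrier_mat d d" "upper_triangular T"
    and diag: "diag_mat T = map complex_of_real ls"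
  shows "poly_mat T (\<Prod>l\<leftarrow>ls. [:- l, 1:]) = 0\<^sub>m d d"
proof -
  have len: "length ls = d" using arg_cong[OF diag, of length] T by (simp add: diag_mat_def)
  have dg: "T $$ (i, i) = complex_of_real (ls ! i)" if "i < d" for i
    using arg_cong[OF diag, of "\<lambda>xs. xs ! i"] that T len by (simp add: diag_mat_def)
  have "\<forall>r < d. \<forall>c < d. r \<ge> d - k \<longrightarrow> poly_mat T (\<Prod>l\<leftarrow>drop (d - k) ls. [:- l, 1:]) $$ (r, c) = 0" if "k \<le> d" for k
    using that
  proof (induction k)
    case 0
    show ?case by auto
  next
    case (Suc k)
    define i where "i = d - Suc k"
    have i: "i < d" "Suc i = d - k" using Suc.prems by (auto simp: i_def)
    define q where "q = (\<Prod>l\<leftarrow>drop (d - k) ls. [:- l, 1:])"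
    define F where "F = T + complex_of_real (- (ls ! i)) \<cdot>\<^sub>m 1\<^sub>m d"
    have F: "F \<in> carrier_mat d d" using T by (simp add: F_def)
    note Qc = poly_mat_carrier[OF T(1), of q]
    have "drop i ls = ls ! i # drop (d - k) ls" using Cons_nth_drop_Suc[of i ls] i len by simp
    hence e: "poly_mat T (\<Prod>l\<leftarrow>drop i ls. [:- l, 1:]) = F * poly_mat T q"
      by (simp only: list.map prod_list.Cons poly_mat_mult[OF T(1)] poly_mat_linear[OF T(1)] q_def F_def)
    have "(F * poly_mat T q) $$ (r, c) = 0" if rc: "r < d" "c < d" "r \<ge> i" for r c
    proof -
      have "(F * poly_mat T q) $$ (r, c) = (\<Sum>a = 0..<d. F $$ (r, a) * poly_mat T q $$ (a, c))"
        using rc F Qc by (auto simp: scalar_prod_def)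
      also have "\<dots> = 0"
      proof (intro sum.neutral ballI)
        fix a assume a: "a \<in> {0..<d}"
        show "F $$ (r, a) * poly_mat T q $$ (a, c) = 0"
        proof (cases "a \<ge> Suc i")
          case True
          thus ?thesis using Suc a rc i by (simp add: q_def)
        next
          case False
          have "F $$ (r, a) = 0"
          proof (cases "a = r")
            case True
            hence "r = i" using False rc by simp
            thus ?thesis using True T a dg[OF i(1)] by (auto simp: F_def)
          next
            case ne: False
            hence "a < r" using False rc by simp
            thus ?thesis using T a rc upper_triangularD[OF T(2), of a r] by (auto simp: F_def)
          qed
          thus ?thesis by simp
        qed
      qed
      finally show ?thesis .
    qed
    thus ?case unfolding i_def[symmetric] e by auto
  qed
  from this[of d] have "\<forall>r < d. \<forall>c < d. poly_mat T (\<Prod>l\<leftarrow>ls. [:- l, 1:]) $$ (r, c) = 0"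
    by simp
  thus ?thesis using poly_mat_carrier[OF T(1), of "\<Prod>l\<leftarrow>ls. [:- l, 1:]"] by (intro eq_matI) auto
qed

text \<open>A form of the Cayley-Hamilton theorem with a real polynomial: all complex roots of the
  characteristic polynomial are negative reals by hypothesis, and a Schur decomposition reduces the
  claim to triangular matrices. The factors are kept as a list, roots with multiplicity, since later
  arguments recurse on it or minimize its length.\<close>

lemma negative_spectrum_annihilator:
  assumes B: "B \<in> carrier_mat d d" and sp: "spectrum_mat B \<subseteq> complex_of_real ` {x. x < 0}"
  obtains ls where "\<forall>l \<in> set ls. l < 0" "poly_mat B (\<Prod>l\<leftarrow>ls. [:- l, 1:]) = 0\<^sub>m d d"
proof -
  obtain es where es: "char_poly B = (\<Prod>a\<leftarrow>es. [:- a, 1:])" using char_poly_factorized[OF B] by auto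
  have "e \<in> complex_of_real ` {x. x < 0}" if "e \<in> set es" for e
  proof -
    have "poly (char_poly B) e = 0" unfolding es using that
      by (simp add: poly_prod_list prod_list_zero_iff)
    hence "eigenvalue B e" using eigenvalue_root_char_poly[OF B] by simp
    thus ?thesis using sp by (auto simp: spectrum_mat_def)
  qed
  hence "\<exists>ls. (\<forall>l\<in>set ls. l < 0) \<and> es = map complex_of_real ls"
  proof (induction es)
    case (Cons e es)
    then obtain ls where "(\<forall>l\<in>set ls. l < 0) \<and> es = map complex_of_real ls" by auto
    moreover obtain l where "l < 0" "e = complex_of_real l" using Cons.prems[of e] by auto
    ultimately show ?case by (intro exI[of _ "l # ls"]) auto
  qed auto
  then obtain ls where ls: "\<forall>l\<in>set ls. l < 0" "es = map complex_of_real ls" by auto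
  obtain T P Q where s: "schur_decomposition B es = (T, P, Q)" by (metis prod_cases3)
  from schur_decomposition[OF B es s] have w: "similar_mat_wit B T P Q" "upper_triangular T"
    and dg: "diag_mat T = map complex_of_real ls" using ls by auto
  note D = similar_mat_witD2[OF B w(1)]
  have "poly_mat B (\<Prod>l\<leftarrow>ls. [:- l, 1:]) = P * poly_mat T (\<Prod>l\<leftarrow>ls. [:- l, 1:]) * Q"
    by (rule poly_mat_similar[of _ d]) (use D in auto)
  also have "\<dots> = 0\<^sub>m d d"
    using upper_triangular_annihilated[OF D(5) w(2) dg] D by simp
  finally show thesis using ls that by blast
qed

section \<open>Roots and complex structures\<close>

lemma pow_mat_add: "A \<in> carrier_mat d d \<Longrightarrow> A ^\<^sub>m (i + j) = A ^\<^sub>m i * A ^\<^sub>m j"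
proof (induction j)
  case 0
  thus ?case using pow_carrier_mat[of A d i] by simp
next
  case (Suc j)
  thus ?case by (simp add: assoc_mult_mat[of _ d d _ d _ d])
qed

lemma pow_mat_mult_commute:
  assumes X: "X \<in> carrier_mat d d" and Y: "Y \<in> carrier_mat d d" and XY: "X * Y = Y * X"
  shows "(X * Y) ^\<^sub>m k = X ^\<^sub>m k * (Y :: complex mat) ^\<^sub>m k"
proof (induction k)
  case 0
  thus ?case using X Y by simp
next
  case (Suc k)
  have cX: "X ^\<^sub>m k \<in> carrier_mat d d" and cY: "Y ^\<^sub>m k \<in> carrier_mat d d" using X Y by auto
  have "X * Y ^\<^sub>m k = Y ^\<^sub>m k * X" for k
  proof (induction k)
    case 0
    thus ?case using X Y by simp
  next
    case (Suc k)
    have c: "Y ^\<^sub>m k \<in> carrier_mat d d" using Y by simp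
    have "X * (Y ^\<^sub>m k * Y) = Y ^\<^sub>m k * X * Y"
      unfolding assoc_mult_mat[OF X c Y, symmetric] Suc.IH ..
    also have "\<dots> = Y ^\<^sub>m k * Y * X"
      unfolding assoc_mult_mat[OF c X Y] XY assoc_mult_mat[OF c Y X] ..
    finally show ?case by simp
  qed
  note comm = this[of k]
  have "(X * Y) ^\<^sub>m Suc k = X ^\<^sub>m k * (Y ^\<^sub>m k * X * Y)"
    using Suc X Y cX cY by (simp add: assoc_mult_mat[of _ d d _ d _ d] mult_carrier_mat[of _ d d])
  also have "\<dots> = X ^\<^sub>m Suc k * Y ^\<^sub>m Suc k"
    unfolding comm[symmetric] using X Y cX cY by (simp add: assoc_mult_mat[of _ d d _ d _ d] mult_carrier_mat[of _ d d])
  finally show ?case .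
qed

text \<open>Since \<open>K\<close> squares to -1, the combinations \<open>a + b K\<close> with real
  \<open>a\<close> and \<open>b\<close> multiply like complex numbers, and \<open>Z t\<close> stands
  for exp(t K).\<close>

lemma complex_structure_de_Moivre:
  assumes K: "K \<in> carrier_mat d d" and KK: "K * K = - 1\<^sub>m d"
  defines "Z \<equiv> \<lambda>t. complex_of_real (cos t) \<cdot>\<^sub>m 1\<^sub>m d + complex_of_real (sin t) \<cdot>\<^sub>m K"
  shows "Z t ^\<^sub>m k = Z (real k * t)"
proof (induction k)
  case 0
  show ?case using K by (auto simp: Z_def intro!: eq_matI)
next
  case (Suc k)
  let ?c = "complex_of_real (cos (real k * t))" and ?s = "complex_of_real (sin (real k * t))"
  let ?c' = "complex_of_real (cos t)" and ?s' = "complex_of_real (sin t)"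
  have Zu: "Z u = complex_of_real (cos u) \<cdot>\<^sub>m 1\<^sub>m d + complex_of_real (sin u) \<cdot>\<^sub>m K" for u
    by (simp add: Z_def)
  have cZ: "Z u \<in> carrier_mat d d" for u using K by (simp add: Z_def)
  have "Z t ^\<^sub>m Suc k = Z (real k * t) * Z t" using Suc by simp
  also have "\<dots> = ?c \<cdot>\<^sub>m Z t + (?s \<cdot>\<^sub>m K) * Z t"
    unfolding Zu[of "real k * t"]
    by (subst add_mult_distrib_mat[of _ d d _ _ d])
      (use K cZ in \<open>auto simp: mult_smult_assoc_mat[OF one_carrier_mat cZ] left_mult_one_mat[OF cZ]\<close>)
  also have "(?s \<cdot>\<^sub>m K) * Z t = ?s \<cdot>\<^sub>m (K * Z t)" by (rule mult_smult_assoc_mat[OF K cZ])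
  also have "K * Z t = ?c' \<cdot>\<^sub>m K + ?s' \<cdot>\<^sub>m (- 1\<^sub>m d)"
    unfolding Zu[of t] KK[symmetric]
    by (subst mult_add_distrib_mat[of _ d d _ d])
      (use K in \<open>auto simp: mult_smult_distrib[OF K K] mult_smult_distrib[OF K one_carrier_mat]\<close>)
  also have "?c \<cdot>\<^sub>m Z t + ?s \<cdot>\<^sub>m (?c' \<cdot>\<^sub>m K + ?s' \<cdot>\<^sub>m (- 1\<^sub>m d)) = Z (real (Suc k) * t)"
    unfolding Zu using K
    by (intro eq_matI) (auto simp: algebra_simps cos_add sin_add)
  finally show ?case .
qed

definition quat_selfadjoint :: "nat \<Rightarrow> complex mat \<Rightarrow> complex mat \<Rightarrow> bool" where
  "quat_selfadjoint N H A \<longleftrightarrow> A \<in> Omega N \<and> H_selfadjoint H A"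

section \<open>Selfadjoint matrices in Omega, closed under real polynomials\<close>

context
  fixes N :: nat and H :: "complex mat"
  assumes H: "H \<in> carrier_mat (N + N) (N + N)"
begin

lemma quat_selfadjoint_one: "quat_selfadjoint N H (1\<^sub>m (N + N))"
proof -
  have "mat_adjoint (1\<^sub>m (N + N)) = (1\<^sub>m (N + N) :: complex mat)" by (rule eq_matI) auto
  thus ?thesis using H by (simp add: quat_selfadjoint_def H_selfadjoint_def)
qed

lemma quat_selfadjoint_zero: "quat_selfadjoint N H (0\<^sub>m (N + N) (N + N))"
proof -
  have "mat_adjoint (0\<^sub>m (N + N) (N + N)) = (0\<^sub>m (N + N) (N + N) :: complex mat)" by (rule eq_matI) auto
  thus ?thesis using H by (simp add: quat_selfadjoint_def H_selfadjoint_def)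
qed

lemma quat_selfadjoint_add:
  assumes "quat_selfadjoint N H A" "quat_selfadjoint N H B"
  shows "quat_selfadjoint N H (A + B)"
proof -
  have c: "A \<in> carrier_mat (N + N) (N + N)" "B \<in> carrier_mat (N + N) (N + N)"
    using assms by (auto simp: quat_selfadjoint_def Omega_carrier)
  have "mat_adjoint (A + B) = mat_adjoint A + mat_adjoint B"
    using c by (intro eq_matI) auto
  thus ?thesis using assms c H
    by (simp add: quat_selfadjoint_def H_selfadjoint_def Omega_add mult_add_distrib_mat[OF H c]
        add_mult_distrib_mat[of _ "N + N" "N + N" _ _ "N + N"])
qed

lemma quat_selfadjoint_smult:
  assumes "quat_selfadjoint N H A"
  shows "quat_selfadjoint N H (complex_of_real a \<cdot>\<^sub>m A)"
proof -
  have c: "A \<in> carrier_mat (N + N) (N + N)"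
    using assms by (auto simp: quat_selfadjoint_def Omega_carrier)
  have "mat_adjoint (complex_of_real a \<cdot>\<^sub>m A) = complex_of_real a \<cdot>\<^sub>m mat_adjoint A"
    using c by (intro eq_matI) auto
  thus ?thesis using assms c H
    by (simp add: quat_selfadjoint_def H_selfadjoint_def Omega_smult mult_smult_distrib[OF H c]
        mult_smult_assoc_mat[of _ "N + N" "N + N" _ "N + N"])
qed

text \<open>Taking adjoints reverses the order of the factors; commutation restores it.\<close>

lemma quat_selfadjoint_mult:
  assumes "quat_selfadjoint N H A" "quat_selfadjoint N H B" "A * B = B * A"
  shows "quat_selfadjoint N H (A * B)"
proof -
  have c: "A \<in> carrier_mat (N + N) (N + N)" "B \<in> carrier_mat (N + N) (N + N)"
    using assms by (auto simp: quat_selfadjoint_def Omega_carrier)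
  have s: "H * A = mat_adjoint A * H" "H * B = mat_adjoint B * H"
    using assms by (auto simp: quat_selfadjoint_def H_selfadjoint_def)
  note a = c[THEN mat_adjoint_carrier]
  have "H * (A * B) = mat_adjoint A * (H * B)"
    by (simp only: assoc_mult_mat[OF H c, symmetric] s(1) assoc_mult_mat[OF a(1) H c(2)])
  also have "\<dots> = mat_adjoint (B * A) * H"
    by (simp only: s(2) assoc_mult_mat[OF a(1,2) H] mat_adjoint_mult[OF c(2,1)])
  finally show ?thesis using assms by (simp add: quat_selfadjoint_def H_selfadjoint_def Omega_mult)
qed

lemma quat_selfadjoint_poly_mat:
  assumes "quat_selfadjoint N H B"
  shows "quat_selfadjoint N H (poly_mat B p)"
proof (induction p)
  have c: "B \<in> carrier_mat (N + N) (N + N)"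
    using assms by (auto simp: quat_selfadjoint_def Omega_carrier)
  {
    case 0
    thus ?case using c quat_selfadjoint_zero by simp
  next
    case (pCons a p)
    thus ?case unfolding poly_mat_pCons[OF c]
      by (intro quat_selfadjoint_add quat_selfadjoint_mult quat_selfadjoint_smult quat_selfadjoint_one
        assms poly_mat_commute[OF c c]) auto
  }
qed

lemma quat_selfadjoint_pow:
  assumes "quat_selfadjoint N H A"
  shows "quat_selfadjoint N H (A ^\<^sub>m k)"
proof (induction k)
  have c: "A \<in> carrier_mat (N + N) (N + N)"
    using assms by (auto simp: quat_selfadjoint_def Omega_carrier)
  {
    case 0
    thus ?case using c quat_selfadjoint_one by simp
  next
    case (Suc k)
    have "A ^\<^sub>m k * A = A * A ^\<^sub>m k"
      using pow_mat_add[OF c, of k 1] pow_mat_add[OF c, of 1 k] c by simp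
    thus ?case using Suc assms by (auto intro: quat_selfadjoint_mult)
  }
qed

text \<open>With a real polynomial square root M of -B, the matrix A^(m/2) M^(-1) squares to -1.\<close>

lemma complex_structure_of_root:
  assumes A: "quat_selfadjoint N H A" "A ^\<^sub>m m = B" and m: "even m" "m > 0"
    and sp: "spectrum_mat B \<subseteq> complex_of_real ` {x. x < 0}"
  shows "\<exists>K. quat_selfadjoint N H K \<and> K * B = B * K \<and> K * K = - 1\<^sub>m (N + N)"
proof -
  let ?d = "N + N"
  obtain k where k: "m = k + k" using m by (metis evenE mult_2)
  define A' where "A' = A ^\<^sub>m k"
  have A': "quat_selfadjoint N H A'" unfolding A'_def by (rule quat_selfadjoint_pow[OF A(1)])
  have cA: "A \<in> carrier_mat ?d ?d" "A' \<in> carrier_mat ?d ?d"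
    using A A' by (auto simp: quat_selfadjoint_def Omega_carrier)
  have AA: "A' * A' = B" using pow_mat_add[OF cA(1), of k k] A(2) by (simp add: A'_def k)
  have B: "quat_selfadjoint N H B" unfolding AA[symmetric] by (rule quat_selfadjoint_mult[OF A' A' refl])
  hence c: "B \<in> carrier_mat ?d ?d" by (auto simp: quat_selfadjoint_def Omega_carrier)
  have comm: "A' * B = B * A'" unfolding AA[symmetric] by (rule assoc_mult_mat[OF cA(2,2,2), symmetric])
  obtain ls where ls: "\<forall>l \<in> set ls. l < 0" "poly_mat B (\<Prod>l\<leftarrow>ls. [:- l, 1:]) = 0\<^sub>m ?d ?d"
    using negative_spectrum_annihilator[OF c sp] by blast
  define q where "q = (\<Prod>l\<leftarrow>ls. [:- l, 1:])"
  obtain p where p: "q dvd p ^ 2 + [:0, 1:]"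
    using real_poly_root_mod_linear_prod[of 2 ls] ls by (auto simp: q_def)
  \<comment> \<open>All roots of \<open>q\<close> are negative, so 0 is not among them; this is
    where the invertibility of \<open>B\<close> comes from.\<close>
  have "poly q 0 \<noteq> 0" using ls(1) by (auto simp: q_def poly_prod_list prod_list_zero_iff)
  then obtain w where w: "q dvd [:0, 1:] * w - 1" using poly_inverse_X_mod by blast
  define X where "X = [:0, 1 :: real:]"
  \<comment> \<open>Modulo \<open>q\<close>, \<open>p ^ 2\<close> is \<open>- X\<close> and
    \<open>w\<close> is the inverse of \<open>X\<close>, so \<open>X * (p * w) ^ 2\<close> is -1.
    The identity displays this as a combination of the two known multiples of
    \<open>q\<close>.\<close>
  have "X * (p * w) * (p * w) + 1 = (p ^ 2 + X) * (X * w ^ 2) - (X * w - 1) * (X * w + 1)"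
    by (simp add: algebra_simps power2_eq_square)
  moreover have "q dvd (p ^ 2 + X) * (X * w ^ 2) - (X * w - 1) * (X * w + 1)"
    using p w unfolding X_def[symmetric] by (rule dvd_diff[OF dvd_mult2 dvd_mult2])
  ultimately have "q dvd X * (p * w) * (p * w) + 1" by simp
  hence z: "poly_mat B (X * (p * w) * (p * w) + 1) = 0\<^sub>m ?d ?d"
    using ls(2) poly_mat_dvd_zero[OF c] unfolding q_def by blast
  \<comment> \<open>With M the matrix of \<open>p\<close>, this is M times the inverse of
    \<open>B\<close>. As M squares to \<open>- B\<close>, it equals minus the inverse of M, and the
    sign has no effect on \<open>K * K\<close>.\<close>
  define R where "R = poly_mat B (p * w)"
  have cR: "R \<in> carrier_mat ?d ?d" using c by (simp add: R_def)
  have RB: "R * B = B * R" using poly_mat_commute[OF c c refl] by (simp add: R_def)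
  have RA: "A' * R = R * A'" using poly_mat_commute[OF c cA(2) comm] by (simp add: R_def)
  have z': "B * R * R + 1\<^sub>m ?d = 0\<^sub>m ?d ?d"
    using z c by (simp only: poly_mat_add[OF c] poly_mat_mult[OF c] X_def poly_mat_X[OF c] R_def[symmetric] poly_mat_1[OF c])
      (simp add: R_def poly_mat_mult[OF c])
  define K where "K = A' * R"
  have "K * K = A' * (R * A') * R"
    unfolding K_def using cA cR by (simp add: assoc_mult_mat[of _ ?d ?d _ ?d _ ?d] mult_carrier_mat[of _ ?d ?d])
  also have "\<dots> = B * R * R"
    unfolding RA[symmetric] AA[symmetric] using cA cR
    by (simp add: assoc_mult_mat[of _ ?d ?d _ ?d _ ?d] mult_carrier_mat[of _ ?d ?d])
  finally have KK: "K * K = B * R * R" .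
  have "B * R * R = - 1\<^sub>m ?d"
  proof (rule eq_matI)
    fix i j assume "i < dim_row (- 1\<^sub>m ?d :: complex mat)" "j < dim_col (- 1\<^sub>m ?d :: complex mat)"
    moreover have "B * R * R \<in> carrier_mat ?d ?d" using c cR by (meson mult_carrier_mat)
    ultimately show "(B * R * R) $$ (i, j) = (- 1\<^sub>m ?d) $$ (i, j)"
      using arg_cong[OF z', of "\<lambda>M. M $$ (i, j)"] by (simp add: eq_neg_iff_add_eq_0 del: index_mult_mat)
  qed (use c cR in auto)
  moreover have "K * B = B * K"
  proof -
    have "K * B = A' * (B * R)" unfolding K_def assoc_mult_mat[OF cA(2) cR c] RB ..
    also have "\<dots> = B * K"
      by (simp only: K_def assoc_mult_mat[OF cA(2) c cR, symmetric] comm assoc_mult_mat[OF c cA(2) cR])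
    finally show ?thesis .
  qed
  moreover have "quat_selfadjoint N H K" unfolding K_def
    by (rule quat_selfadjoint_mult[OF A' _ RA]) (simp add: R_def quat_selfadjoint_poly_mat[OF B])
  ultimately show ?thesis using KK by auto
qed

lemma root_of_complex_structure:
  assumes B: "quat_selfadjoint N H B" and sp: "spectrum_mat B \<subseteq> complex_of_real ` {x. x < 0}"
    and K: "quat_selfadjoint N H K" "K * B = B * K" "K * K = - 1\<^sub>m (N + N)" and m: "m > 0"
  shows "\<exists>A. quat_selfadjoint N H A \<and> A ^\<^sub>m m = B"
proof -
  let ?d = "N + N"
  have c: "B \<in> carrier_mat ?d ?d" "K \<in> carrier_mat ?d ?d"
    using B K by (auto simp: quat_selfadjoint_def Omega_carrier)
  obtain ls where ls: "\<forall>l \<in> set ls. l < 0" "poly_mat B (\<Prod>l\<leftarrow>ls. [:- l, 1:]) = 0\<^sub>m ?d ?d"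
    using negative_spectrum_annihilator[OF c(1) sp] by blast
  obtain p where p: "(\<Prod>l\<leftarrow>ls. [:- l, 1:]) dvd p ^ m + [:0, 1:]"
    using real_poly_root_mod_linear_prod[OF m] ls by blast
  define M where "M = poly_mat B p"
  have cM: "M \<in> carrier_mat ?d ?d" using c by (simp add: M_def)
  have "M ^\<^sub>m m + B = 0\<^sub>m ?d ?d"
    using poly_mat_dvd_zero[OF c(1) ls(2) p]
    by (simp only: poly_mat_add[OF c(1)] poly_mat_power[OF c(1)] poly_mat_X[OF c(1)] M_def)
  note z = this
  have Mm: "M ^\<^sub>m m = - B"
  proof (rule eq_matI)
    fix i j assume "i < dim_row (- B)" "j < dim_col (- B)"
    thus "(M ^\<^sub>m m) $$ (i, j) = (- B) $$ (i, j)"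
      using arg_cong[OF z, of "\<lambda>M. M $$ (i, j)"] c pow_carrier_mat[OF cM, of m] by (simp add: eq_neg_iff_add_eq_0)
  qed (use c cM in auto)
  \<comment> \<open>The angle is chosen so that the power \<open>Z ^\<^sub>m m\<close> is cos(pi) +
    sin(pi) K, that is -1, which cancels the sign in \<open>M ^\<^sub>m m = - B\<close>.\<close>
  define t where "t = pi / real m"
  define Z where "Z = complex_of_real (cos t) \<cdot>\<^sub>m 1\<^sub>m ?d + complex_of_real (sin t) \<cdot>\<^sub>m K"
  have cZ: "Z \<in> carrier_mat ?d ?d" using c by (simp add: Z_def)
  have Zm: "Z ^\<^sub>m m = - 1\<^sub>m ?d"
    using complex_structure_de_Moivre[OF c(2) K(3), where t = t and k = m] m c unfolding Z_def t_def
    by (auto intro!: eq_matI)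
  have MK: "K * M = M * K" unfolding M_def by (rule poly_mat_commute[OF c K(2)])
  have MZ: "M * Z = Z * M"
    unfolding Z_def using c cM
    by (subst mult_add_distrib_mat[of _ ?d ?d _ ?d], simp, simp, simp, subst add_mult_distrib_mat[of _ ?d ?d _ _ ?d])
      (auto simp: mult_smult_distrib[OF cM c(2)] mult_smult_distrib[OF cM one_carrier_mat]
        mult_smult_assoc_mat[OF c(2) cM] mult_smult_assoc_mat[OF one_carrier_mat cM] MK)
  have "(M * Z) ^\<^sub>m m = B"
    unfolding pow_mat_mult_commute[OF cM cZ MZ] Mm Zm using c by simp
  moreover have "quat_selfadjoint N H (M * Z)"
    by (rule quat_selfadjoint_mult[OF _ _ MZ])
      (auto simp: M_def Z_def intro!: quat_selfadjoint_poly_mat[OF B] quat_selfadjoint_add quat_selfadjoint_smult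
        quat_selfadjoint_one K)
  ultimately show ?thesis by blast
qed

end

section \<open>Indefinite quaternionic inner products with a complex structure\<close>

text \<open>The invertibility of \<open>H\<close> enters as the triviality of its kernel, the form
  in which nondegeneracy of the inner product is used.\<close>

locale quat_complex_structure =
  fixes N :: nat and H B K :: "complex mat"
  assumes H_Omega: "H \<in> Omega N" and H_adj: "mat_adjoint H = H"
    and H_inj: "\<And>x. x \<in> carrier_vec (N + N) \<Longrightarrow> H *\<^sub>v x = 0\<^sub>v (N + N) \<Longrightarrow> x = 0\<^sub>v (N + N)"
    and B_sa: "quat_selfadjoint N H B" and K_sa: "quat_selfadjoint N H K"
    and KB: "K * B = B * K" and KK: "K * K = - 1\<^sub>m (N + N)"
    and B_neg: "spectrum_mat B \<subseteq> complex_of_real ` {x. x < 0}"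
begin

abbreviation "d \<equiv> N + N"
abbreviation "V \<equiv> carrier_vec (N + N) :: complex vec set"

section \<open>The quaternionic structure, the Hermitian form and the action of real polynomials on
  vectors\<close>

definition J :: "complex vec \<Rightarrow> complex vec" where "J x = quat_mat N *\<^sub>v conjugate x"
text \<open>The order of the arguments makes the form linear in the second and conjugate-linear in
  the first one, so that the entries of \<open>mat_adjoint X * H * Y\<close> are the values of
  \<open>h\<close> on columns of \<open>X\<close> and \<open>Y\<close>.\<close>

definition h :: "complex vec \<Rightarrow> complex vec \<Rightarrow> complex" where "h x y = (H *\<^sub>v y) \<bullet>c x"
definition pv :: "real poly \<Rightarrow> complex vec \<Rightarrow> complex vec" where "pv p x = poly_mat B p *\<^sub>v x"

lemma carriers [simp]: "H \<in> carrier_mat d d" "B \<in> carrier_mat d d" "K \<in> carrier_mat d d"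
  using H_Omega B_sa K_sa by (auto simp: quat_selfadjoint_def Omega_carrier)

lemma dims [simp]: "dim_row H = d" "dim_col H = d" "dim_row B = d" "dim_col B = d" "dim_row K = d" "dim_col K = d"
  using carriers by blast+

lemma zero_smult [simp]: "x \<in> V \<Longrightarrow> 0 \<cdot>\<^sub>v x = 0\<^sub>v d"
  by (intro eq_vecI) auto

lemma smult_0v [simp]: "a \<cdot>\<^sub>v 0\<^sub>v d = (0\<^sub>v d :: complex vec)"
  by (intro eq_vecI) auto

lemma mv_0 [simp]: "M \<in> carrier_mat d d \<Longrightarrow> M *\<^sub>v (0\<^sub>v d) = (0\<^sub>v d :: complex vec)"
  by (intro eq_vecI) auto

lemma zero_mv [simp]: "x \<in> V \<Longrightarrow> 0\<^sub>m d d *\<^sub>v x = 0\<^sub>v d"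
  by (intro eq_vecI) auto

lemma smult_one_mv [simp]: "x \<in> V \<Longrightarrow> (a \<cdot>\<^sub>m 1\<^sub>m d) *\<^sub>v x = a \<cdot>\<^sub>v x"
proof (rule eq_vecI)
  fix i assume x: "x \<in> V" and "i < dim_vec (a \<cdot>\<^sub>v x)"
  hence i: "i < d" by simp
  have "((a \<cdot>\<^sub>m 1\<^sub>m d) *\<^sub>v x) $ i = (a \<cdot>\<^sub>v unit_vec d i) \<bullet> x" using i by simp
  also have "\<dots> = a * x $ i" using i x by (simp add: smult_scalar_prod_distrib[of _ d])
  finally show "((a \<cdot>\<^sub>m 1\<^sub>m d) *\<^sub>v x) $ i = (a \<cdot>\<^sub>v x) $ i" using i x by simp
qed simp

lemma mv_closed [simp]: "M \<in> carrier_mat d d \<Longrightarrow> x \<in> V \<Longrightarrow> M *\<^sub>v x \<in> V"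
  by (rule mult_mat_vec_carrier)

lemma mv_add: "M \<in> carrier_mat d d \<Longrightarrow> x \<in> V \<Longrightarrow> y \<in> V \<Longrightarrow> M *\<^sub>v (x + y) = M *\<^sub>v x + M *\<^sub>v y"
  by (rule mult_add_distrib_mat_vec)

lemma mv_smult: "M \<in> carrier_mat d d \<Longrightarrow> x \<in> V \<Longrightarrow> M *\<^sub>v (a \<cdot>\<^sub>v x) = a \<cdot>\<^sub>v (M *\<^sub>v (x :: complex vec))"
  by (rule mult_mat_vec)

lemma vec_smult_eq_0: "x \<in> V \<Longrightarrow> a \<cdot>\<^sub>v x = 0\<^sub>v d \<Longrightarrow> a \<noteq> 0 \<Longrightarrow> x = 0\<^sub>v d"
proof (rule eq_vecI)
  fix i assume a: "x \<in> V" "a \<cdot>\<^sub>v x = 0\<^sub>v d" "a \<noteq> 0" "i < dim_vec (0\<^sub>v d :: complex vec)"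
  have "(a \<cdot>\<^sub>v x) $ i = 0" using a(2,4) by simp
  thus "x $ i = 0\<^sub>v d $ i" using a(1,3,4) by simp
qed simp

lemma J_closed [simp]: "x \<in> V \<Longrightarrow> J x \<in> V"
  unfolding J_def by (rule mv_closed) auto

lemma J_dim [simp]: "x \<in> V \<Longrightarrow> dim_vec (J x) = d"
  using J_closed carrier_vecD by blast

lemma J_add: "x \<in> V \<Longrightarrow> y \<in> V \<Longrightarrow> J (x + y) = J x + J y"
  unfolding J_def by (simp add: conjugate_add_vec[of _ d] mv_add)

lemma J_smult: "x \<in> V \<Longrightarrow> J (a \<cdot>\<^sub>v x) = cnj a \<cdot>\<^sub>v J x"
  unfolding J_def by (simp add: conjugate_smult_vec mv_smult)

lemma J_J: "x \<in> V \<Longrightarrow> J (J x) = (- 1) \<cdot>\<^sub>v x"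
proof -
  assume x: "x \<in> V"
  have "J (J x) = quat_mat N *\<^sub>v (quat_mat N *\<^sub>v x)"
    unfolding J_def using x by (simp add: conjugate_mult_mat_vec[of _ d d] quat_mat_cnj)
  also have "\<dots> = (quat_mat N * quat_mat N) *\<^sub>v x"
    by (rule assoc_mult_mat_vec[symmetric]) (use x in auto)
  also have "\<dots> = (- 1) \<cdot>\<^sub>v x" unfolding quat_mat_square using x by (intro eq_vecI) auto
  finally show ?thesis .
qed

lemma J_0 [simp]: "J (0\<^sub>v d) = 0\<^sub>v d"
  using J_smult[of "0\<^sub>v d" 0] by simp

lemma J_inj: "x \<in> V \<Longrightarrow> J x = 0\<^sub>v d \<Longrightarrow> x = 0\<^sub>v d"
  using J_J[of x] vec_smult_eq_0[of x "- 1"] by simp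

lemma J_mat: "M \<in> Omega N \<Longrightarrow> x \<in> V \<Longrightarrow> M *\<^sub>v J x = J (M *\<^sub>v x)"
proof -
  assume M: "M \<in> Omega N" and x: "x \<in> V"
  note c = Omega_carrier[OF M]
  have "M *\<^sub>v J x = (M * quat_mat N) *\<^sub>v conjugate x"
    unfolding J_def by (rule assoc_mult_mat_vec[symmetric]) (use c x in auto)
  also have "\<dots> = (quat_mat N * map_mat cnj M) *\<^sub>v conjugate x" using M by (simp add: Omega_iff)
  also have "\<dots> = J (M *\<^sub>v x)" unfolding J_def conjugate_mult_mat_vec[OF c x]
    by (rule assoc_mult_mat_vec) (use c x in auto)
  finally show ?thesis .
qed

lemma cnj_cscalar_prod: "x \<in> V \<Longrightarrow> y \<in> V \<Longrightarrow> cnj (x \<bullet>c y) = y \<bullet>c x"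
  by (auto simp: scalar_prod_def mult.commute)

lemma h_add_right: "x \<in> V \<Longrightarrow> y \<in> V \<Longrightarrow> z \<in> V \<Longrightarrow> h x (y + z) = h x y + h x z"
  unfolding h_def by (simp add: mv_add add_scalar_prod_distrib[of _ d])

lemma h_smult_right: "x \<in> V \<Longrightarrow> y \<in> V \<Longrightarrow> h x (a \<cdot>\<^sub>v y) = a * h x y"
  unfolding h_def by (simp add: mv_smult smult_scalar_prod_distrib[of _ d])

lemma h_sym: "x \<in> V \<Longrightarrow> y \<in> V \<Longrightarrow> h y x = cnj (h x y)"
  unfolding h_def
  by (simp add: cnj_cscalar_prod cscalar_prod_mat_adjoint[of _ d d] H_adj)

lemma h_add_left: "x \<in> V \<Longrightarrow> y \<in> V \<Longrightarrow> z \<in> V \<Longrightarrow> h (y + z) x = h y x + h z x"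
  using h_sym[of x "y + z"] h_sym[of x y] h_sym[of x z] h_add_right[of x y z] by simp

lemma h_smult_left: "x \<in> V \<Longrightarrow> y \<in> V \<Longrightarrow> h (a \<cdot>\<^sub>v y) x = cnj a * h y x"
  using h_sym[of x "a \<cdot>\<^sub>v y"] h_sym[of x y] h_smult_right[of x y a] by simp

lemma h_0 [simp]: "x \<in> V \<Longrightarrow> h x (0\<^sub>v d) = 0" "x \<in> V \<Longrightarrow> h (0\<^sub>v d) x = 0"
  using h_smult_right[of x x 0] h_smult_left[of x x 0] by simp_all

lemma h_selfadjoint:
  assumes M: "quat_selfadjoint N H M" and x: "x \<in> V" "y \<in> V"
  shows "h (M *\<^sub>v x) y = h x (M *\<^sub>v y)"
proof -
  have c: "M \<in> carrier_mat d d" and s: "H * M = mat_adjoint M * H"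
    using M by (auto simp: quat_selfadjoint_def Omega_carrier H_selfadjoint_def)
  have "h (M *\<^sub>v x) y = (mat_adjoint M *\<^sub>v (H *\<^sub>v y)) \<bullet>c x"
    unfolding h_def by (rule cscalar_prod_mat_adjoint) (use c x in auto)
  also have "mat_adjoint M *\<^sub>v (H *\<^sub>v y) = (mat_adjoint M * H) *\<^sub>v y"
    by (rule assoc_mult_mat_vec[symmetric, of _ d d _ d]) (use c x in auto)
  also have "\<dots> = H *\<^sub>v (M *\<^sub>v y)"
    unfolding s[symmetric] by (rule assoc_mult_mat_vec[of _ d d _ d]) (use c x in auto)
  finally show ?thesis unfolding h_def .
qed

text \<open>\<open>H\<close> commutes with \<open>J\<close>, and \<open>J\<close> is antiunitary for
  the standard product because the adjoint of \<open>quat_mat N\<close> is its inverse.\<close>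

lemma h_J: "x \<in> V \<Longrightarrow> y \<in> V \<Longrightarrow> h (J x) (J y) = cnj (h x y)"
proof -
  assume x: "x \<in> V" and y: "y \<in> V"
  let ?P = "quat_mat N" and ?z = "conjugate (H *\<^sub>v y)"
  have z: "?z \<in> V" using y by simp
  have "h (J x) (J y) = (?P *\<^sub>v ?z) \<bullet>c (?P *\<^sub>v conjugate x)"
    unfolding h_def J_mat[OF H_Omega y] by (simp add: J_def)
  also have "\<dots> = (mat_adjoint ?P *\<^sub>v (?P *\<^sub>v ?z)) \<bullet>c conjugate x"
    by (rule cscalar_prod_mat_adjoint) (use x z in auto)
  also have "mat_adjoint ?P *\<^sub>v (?P *\<^sub>v ?z) = (- (?P * ?P)) *\<^sub>v ?z"
    using assoc_mult_mat_vec[of "- ?P" d d ?P d ?z] z by (simp add: quat_mat_adjoint)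
  also have "\<dots> = ?z" unfolding quat_mat_square using z by simp
  also have "?z \<bullet>c conjugate x = cnj (h x y)"
    unfolding h_def using x y by (auto simp: scalar_prod_def)
  finally show ?thesis .
qed

text \<open>Two conjugate-linearities cancel, so \<open>h (J x) y\<close> is bilinear in
  \<open>x\<close> and \<open>y\<close>. The sign comes from \<open>J\<close> squaring to -1,
  together with Hermitian symmetry.\<close>

lemma h_J_skew: "x \<in> V \<Longrightarrow> y \<in> V \<Longrightarrow> h (J x) y = - h (J y) x"
proof -
  assume x: "x \<in> V" and y: "y \<in> V"
  have "cnj (h (J x) y) = h (J (J x)) (J y)" using x y by (simp add: h_J)
  also have "\<dots> = cnj (- h (J y) x)" using x y h_sym[of "J y" x] by (simp add: J_J h_smult_left)
  finally show ?thesis by (simp only: complex_cnj_cancel_iff)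
qed

lemma poly_mat_sa: "quat_selfadjoint N H (poly_mat B p)"
  by (rule quat_selfadjoint_poly_mat[OF carriers(1) B_sa])

lemma pv_closed [simp]: "x \<in> V \<Longrightarrow> pv p x \<in> V"
  by (simp add: pv_def)

lemma pv_dim [simp]: "x \<in> V \<Longrightarrow> dim_vec (pv p x) = d"
  using pv_closed carrier_vecD by blast

lemma pv_mult: "x \<in> V \<Longrightarrow> pv (p * q) x = pv p (pv q x)"
  unfolding pv_def poly_mat_mult[OF carriers(2)] by (rule assoc_mult_mat_vec[of _ d d _ d]) auto

lemma pv_add: "x \<in> V \<Longrightarrow> pv (p + q) x = pv p x + pv q x"
  unfolding pv_def poly_mat_add[OF carriers(2)] by (rule add_mult_distrib_mat_vec[of _ d d]) auto

lemma pv_1 [simp]: "x \<in> V \<Longrightarrow> pv 1 x = x"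
  unfolding pv_def by (simp add: poly_mat_1[OF carriers(2)])

lemma pv_vec_add: "x \<in> V \<Longrightarrow> y \<in> V \<Longrightarrow> pv p (x + y) = pv p x + pv p y"
  unfolding pv_def by (rule mv_add) auto

lemma pv_vec_smult: "x \<in> V \<Longrightarrow> pv p (a \<cdot>\<^sub>v x) = a \<cdot>\<^sub>v pv p x"
  unfolding pv_def by (rule mv_smult) auto

lemma pv_0 [simp]: "pv p (0\<^sub>v d) = 0\<^sub>v d"
  unfolding pv_def by simp

lemma pv_J: "x \<in> V \<Longrightarrow> pv p (J x) = J (pv p x)"
  unfolding pv_def using poly_mat_sa by (intro J_mat) (auto simp: quat_selfadjoint_def)

lemma pv_K: "x \<in> V \<Longrightarrow> pv p (K *\<^sub>v x) = K *\<^sub>v pv p x"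
  unfolding pv_def
  using poly_mat_commute[OF carriers(2,3) KB, of p]
    assoc_mult_mat_vec[of "poly_mat B p" d d K d x] assoc_mult_mat_vec[of K d d "poly_mat B p" d x] by simp

lemma h_pv: "x \<in> V \<Longrightarrow> y \<in> V \<Longrightarrow> h (pv p x) y = h x (pv p y)"
  unfolding pv_def by (rule h_selfadjoint[OF poly_mat_sa])

lemma h_K: "x \<in> V \<Longrightarrow> y \<in> V \<Longrightarrow> h (K *\<^sub>v x) y = h x (K *\<^sub>v y)"
  by (rule h_selfadjoint[OF K_sa])

lemma K_J: "x \<in> V \<Longrightarrow> K *\<^sub>v J x = J (K *\<^sub>v x)"
  using K_sa by (intro J_mat) (auto simp: quat_selfadjoint_def)

lemma K_K: "x \<in> V \<Longrightarrow> K *\<^sub>v (K *\<^sub>v x) = (- 1) \<cdot>\<^sub>v x"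
proof -
  assume x: "x \<in> V"
  have "K *\<^sub>v (K *\<^sub>v x) = (- 1\<^sub>m d) *\<^sub>v x"
    unfolding KK[symmetric] by (rule assoc_mult_mat_vec[symmetric, of _ d d _ d]) (use x in auto)
  also have "\<dots> = (- 1) \<cdot>\<^sub>v x" using x by (intro eq_vecI) auto
  finally show ?thesis .
qed

text \<open>Synthetic division splits \<open>r\<close> into its value at \<open>l\<close> and a
  multiple of the linear factor that kills \<open>x\<close>.\<close>

lemma pv_eigen:
  assumes x: "x \<in> V" and ev: "pv [:- l, 1:] x = 0\<^sub>v d"
  shows "pv r x = complex_of_real (poly r l) \<cdot>\<^sub>v x"
proof -
  have "r = Polynomial.smult (poly r l) 1 + synthetic_div r l * [:- l, 1:]"
    using synthetic_div_correct'[of l r] by (simp add: algebra_simps one_pCons)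
  hence "pv r x = pv (Polynomial.smult (poly r l) 1) x + pv (synthetic_div r l * [:- l, 1:]) x"
    using pv_add[OF x] by metis
  also have "pv (synthetic_div r l * [:- l, 1:]) x = 0\<^sub>v d"
    unfolding pv_mult[OF x] ev by simp
  also have "pv (Polynomial.smult (poly r l) 1) x = complex_of_real (poly r l) \<cdot>\<^sub>v x"
    unfolding pv_def poly_mat_smult[OF carriers(2)] poly_mat_1[OF carriers(2)] using x by simp
  finally show ?thesis using x by simp
qed

section \<open>The eigenspace of the complex structure for the eigenvalue i\<close>

definition Vp :: "complex vec set" where "Vp = {x \<in> V. K *\<^sub>v x = \<i> \<cdot>\<^sub>v x}"

lemma Vp_V: "x \<in> Vp \<Longrightarrow> x \<in> V" by (simp add: Vp_def)

text \<open>Moving \<open>K\<close> across the form compares the factor -i, coming out of the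
  conjugate-linear argument, with the factor i.\<close>

lemma Vp_isotropic: "x \<in> Vp \<Longrightarrow> y \<in> Vp \<Longrightarrow> h x y = 0"
proof -
  assume x: "x \<in> Vp" and y: "y \<in> Vp"
  have "h (\<i> \<cdot>\<^sub>v x) y = h x (\<i> \<cdot>\<^sub>v y)" using h_K[of x y] x y by (simp add: Vp_def)
  hence "- \<i> * h x y = \<i> * h x y" using x y by (simp add: h_smult_left h_smult_right Vp_V)
  thus ?thesis by (simp add: complex_eq_iff)
qed

lemma Vp_pv: "x \<in> Vp \<Longrightarrow> pv p x \<in> Vp"
  using pv_K[of x p] pv_vec_smult[of x p \<i>] by (simp add: Vp_def)

lemma Vp_add: "x \<in> Vp \<Longrightarrow> y \<in> Vp \<Longrightarrow> x + y \<in> Vp"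
  by (simp add: Vp_def mv_add smult_add_distrib_vec[of _ d])

lemma Vp_smult: "x \<in> Vp \<Longrightarrow> a \<cdot>\<^sub>v x \<in> Vp"
  by (auto simp: Vp_def mv_smult smult_smult_assoc mult.commute)

text \<open>This vector is twice the projection of \<open>x\<close> to the eigenspace of
  \<open>K\<close> for i along the one for -i.\<close>

lemma Vp_proj: "x \<in> V \<Longrightarrow> x + (- \<i>) \<cdot>\<^sub>v (K *\<^sub>v x) \<in> Vp"
  by (auto simp: Vp_def mv_add mv_smult K_K algebra_simps intro!: eq_vecI simp del: index_mult_mat_vec)

text \<open>The argument of \<open>J\<close> is twice the complementary projection. It lies in the
  eigenspace for -i, which \<open>J\<close> maps into \<open>Vp\<close>, being antilinear and
  commuting with \<open>K\<close>.\<close>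

lemma Vp_J_proj: "x \<in> V \<Longrightarrow> J (x + \<i> \<cdot>\<^sub>v (K *\<^sub>v x)) \<in> Vp"
proof -
  assume x: "x \<in> V"
  have "K *\<^sub>v (x + \<i> \<cdot>\<^sub>v (K *\<^sub>v x)) = (- \<i>) \<cdot>\<^sub>v (x + \<i> \<cdot>\<^sub>v (K *\<^sub>v x))"
    using x by (auto simp: mv_add mv_smult K_K algebra_simps intro!: eq_vecI simp del: index_mult_mat_vec)
  thus ?thesis using x by (simp add: Vp_def K_J J_smult)
qed

text \<open>Subspaces are plain sets with closure conditions, so orthogonal complements can be
  treated without choosing bases or computing their dimensions.\<close>

definition invariant :: "complex vec set \<Rightarrow> bool" where
  "invariant W \<longleftrightarrow> W \<subseteq> V \<and> (\<forall>x\<in>W. \<forall>y\<in>W. x + y \<in> W) \<and> (\<forall>x\<in>W. \<forall>a. a \<cdot>\<^sub>v x \<in> W) \<and>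
     (\<forall>x\<in>W. B *\<^sub>v x \<in> W \<and> K *\<^sub>v x \<in> W \<and> J x \<in> W)"

definition nondegenerate :: "complex vec set \<Rightarrow> bool" where
  "nondegenerate W \<longleftrightarrow> (\<forall>x\<in>W. (\<forall>y\<in>W. h x y = 0) \<longrightarrow> x = 0\<^sub>v d)"

lemma invariant_pv: "invariant W \<Longrightarrow> x \<in> W \<Longrightarrow> pv p x \<in> W"
proof (induction p)
  case 0
  have "x \<in> V" using 0 by (auto simp: invariant_def)
  \<comment> \<open>The zero vector belongs to \<open>W\<close> as a multiple of
    \<open>x\<close>.\<close>
  hence "pv 0 x = 0 \<cdot>\<^sub>v x" by (simp add: pv_def)
  thus ?case using 0 by (simp add: invariant_def)
next
  case (pCons a p)
  have x: "x \<in> V" using pCons.prems by (auto simp: invariant_def)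
  have "pv (pCons a p) x = complex_of_real a \<cdot>\<^sub>v x + B *\<^sub>v pv p x"
    unfolding pv_def poly_mat_pCons[OF carriers(2)] using x
    by (subst add_mult_distrib_mat_vec[of _ d d])
      (auto simp: mult_carrier_mat[of _ d d] assoc_mult_mat_vec[of B d d _ d] intro!: eq_vecI simp del: index_mult_mat_vec index_mult_mat)
  thus ?case using pCons by (simp add: invariant_def)
qed

text \<open>Up to a factor, \<open>x\<close> is the sum of its two projections: the first lies in
  \<open>Vp\<close>, the second does so after applying \<open>J\<close>. Real polynomials in
  \<open>B\<close> commute with \<open>K\<close> and \<open>J\<close>, so both projections of
  \<open>y\<close> vanish, and their sum is \<open>2 y\<close>.\<close>

lemma invariant_killed_by_poly:
  assumes W: "invariant W" and kill: "\<And>x. x \<in> W \<inter> Vp \<Longrightarrow> pv p x = 0\<^sub>v d" and x: "x \<in> W"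
  shows "pv p x = 0\<^sub>v d"
proof -
  have xV: "x \<in> V" using W x by (auto simp: invariant_def)
  define y where "y = pv p x"
  have y: "y \<in> V" using xV by (simp add: y_def)
  have "x + (- \<i>) \<cdot>\<^sub>v (K *\<^sub>v x) \<in> W \<inter> Vp" using W x Vp_proj[OF xV] by (auto simp: invariant_def)
  from kill[OF this] have 1: "y + (- \<i>) \<cdot>\<^sub>v (K *\<^sub>v y) = 0\<^sub>v d"
    using xV by (simp add: pv_vec_add pv_vec_smult pv_K y_def)
  have "J (x + \<i> \<cdot>\<^sub>v (K *\<^sub>v x)) \<in> W \<inter> Vp" using W x Vp_J_proj[OF xV] by (auto simp: invariant_def)
  from kill[OF this] have "J (y + \<i> \<cdot>\<^sub>v (K *\<^sub>v y)) = 0\<^sub>v d"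
    using xV by (simp add: pv_J pv_vec_add pv_vec_smult pv_K y_def)
  hence 2: "y + \<i> \<cdot>\<^sub>v (K *\<^sub>v y) = 0\<^sub>v d"
    by (rule J_inj[rotated]) (rule add_carrier_vec, use y in simp_all)
  have "y = 0\<^sub>v d"
  proof (rule eq_vecI)
    fix i assume "i < dim_vec (0\<^sub>v d :: complex vec)"
    hence i: "i < d" by simp
    have "y $ i + (- \<i>) * (K *\<^sub>v y) $ i = 0" using arg_cong[OF 1, of "\<lambda>v. v $ i"] i y
      by (simp del: index_mult_mat_vec)
    moreover have "y $ i + \<i> * (K *\<^sub>v y) $ i = 0" using arg_cong[OF 2, of "\<lambda>v. v $ i"] i y
      by (simp del: index_mult_mat_vec)
    ultimately have "y $ i = 0" by simp
    thus "y $ i = 0\<^sub>v d $ i" using i by simp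
  qed (use y in simp)
  thus ?thesis by (simp add: y_def)
qed

text \<open>\<open>J z\<close> is an eigenvector of \<open>K\<close> for -i and hence pairs
  trivially with the -i part of any vector. Replacing \<open>y\<close> by twice its part in
  \<open>Vp\<close> therefore only doubles the product.\<close>

lemma Vp_nondegenerate:
  assumes W: "invariant W" "nondegenerate W" and z: "z \<in> W \<inter> Vp" "z \<noteq> 0\<^sub>v d"
  shows "\<exists>y \<in> W \<inter> Vp. h (J z) y \<noteq> 0"
proof -
  have zV: "z \<in> V" using z Vp_V by auto
  have "J z \<in> W" "J z \<noteq> 0\<^sub>v d" using W z J_inj[OF zV] by (auto simp: invariant_def)
  then obtain y where y: "y \<in> W" "h (J z) y \<noteq> 0" using W by (auto simp: nondegenerate_def)
  have yV: "y \<in> V" using W y by (auto simp: invariant_def)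
  have "K *\<^sub>v J z = (- \<i>) \<cdot>\<^sub>v J z" using z zV by (simp add: K_J Vp_def J_smult)
  hence "h (J z) (K *\<^sub>v y) = \<i> * h (J z) y"
    using h_K[of "J z" y] zV yV by (simp add: h_smult_left)
  hence "h (J z) (y + (- \<i>) \<cdot>\<^sub>v (K *\<^sub>v y)) = 2 * h (J z) y"
    using zV yV by (simp add: h_add_right h_smult_right)
  moreover have "y + (- \<i>) \<cdot>\<^sub>v (K *\<^sub>v y) \<in> W \<inter> Vp" using W y Vp_proj[OF yV] by (auto simp: invariant_def)
  ultimately show ?thesis using y(2) by (intro bexI[of _ "y + (- \<i>) \<cdot>\<^sub>v (K *\<^sub>v y)"]) auto
qed

text \<open>Taking a shortest list of linear factors whose product annihilates the part of W in the
  i-eigenspace of K gives a vector z on the bottom of a chain of maximal length for the eigenvalue l;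
  since the factors with other roots act on z as a nonzero scalar, they can be moved to both
  sides of the form.\<close>

lemma dual_chain_tops:
  assumes W: "invariant W" "nondegenerate W" and w: "w \<in> W" "w \<noteq> 0\<^sub>v d"
  shows "\<exists>l k e f. l < 0 \<and> e \<in> W \<inter> Vp \<and> f \<in> W \<inter> Vp \<and>
    pv ([:- l, 1:] ^ Suc k) e = 0\<^sub>v d \<and> pv ([:- l, 1:] ^ Suc k) f = 0\<^sub>v d \<and>
    h (J e) (pv ([:- l, 1:] ^ k) f) \<noteq> 0"
proof -
  define P where "P ls \<longleftrightarrow> (\<forall>l\<in>set ls. l < 0) \<and> (\<forall>x \<in> W \<inter> Vp. pv (\<Prod>l\<leftarrow>ls. [:- l, 1:]) x = 0\<^sub>v d)"
    for ls :: "real list"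
  obtain ls0 where "\<forall>l \<in> set ls0. l < 0" "poly_mat B (\<Prod>l\<leftarrow>ls0. [:- l, 1:]) = 0\<^sub>m d d"
    using negative_spectrum_annihilator[OF carriers(2) B_neg] by blast
  hence "P ls0" unfolding P_def by (auto simp: pv_def dest: Vp_V)
  obtain ls where ls: "P ls" and min: "\<And>ls'. length ls' < length ls \<Longrightarrow> \<not> P ls'"
    using ex_has_least_nat[of P ls0 length] \<open>P ls0\<close> by (meson not_le)
  \<comment> \<open>The empty product is 1; if it annihilated the part of \<open>W\<close> in
    \<open>Vp\<close>, it would annihilate \<open>w\<close>.\<close>
  have "ls \<noteq> []"
  proof
    assume "ls = []"
    hence "pv 1 x = 0\<^sub>v d" if "x \<in> W \<inter> Vp" for x using ls that by (auto simp: P_def)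
    hence "pv 1 w = 0\<^sub>v d" by (rule invariant_killed_by_poly[OF W(1) _ w(1)])
    thus False using w W by (auto simp: invariant_def)
  qed
  then obtain l ls' where l: "ls = l # ls'" by (cases ls) auto
  define q where "q = (\<Prod>l\<leftarrow>ls'. [:- l, 1:])"
  define n where "n = [:- l, 1:]"
  have "\<not> P ls'" using min[of ls'] l by simp
  then obtain x where x: "x \<in> W \<inter> Vp" "pv q x \<noteq> 0\<^sub>v d"
    using ls unfolding P_def l q_def by auto
  have kill: "pv (n * q) y = 0\<^sub>v d" if "y \<in> W \<inter> Vp" for y
    using ls that unfolding P_def l q_def n_def by (simp only: list.map prod_list.Cons)
  have "q \<noteq> 0" unfolding q_def by (auto simp: prod_list_zero_iff)
  then obtain r where r: "q = n ^ Polynomial.order l q * r" "\<not> n dvd r"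
    using order_decomp[of q l] unfolding n_def by blast
  define k where "k = Polynomial.order l q"
  have rl: "poly r l \<noteq> 0" using r(2) by (simp add: n_def poly_eq_0_iff_dvd)
  define z where "z = pv q x"
  have xV: "x \<in> V" using x Vp_V by auto
  have z: "z \<in> W \<inter> Vp" "z \<noteq> 0\<^sub>v d" using x W(1) Vp_pv by (auto simp: z_def invariant_pv)
  have zV: "z \<in> V" using z Vp_V by auto
  have nz: "pv [:- l, 1:] z = 0\<^sub>v d" using kill[OF x(1)] pv_mult[OF xV, of n q] by (simp only: z_def n_def)
  obtain y where y: "y \<in> W \<inter> Vp" "h (J z) y \<noteq> 0" using Vp_nondegenerate[OF W z] by blast
  have yV: "y \<in> V" using y Vp_V by auto
  \<comment> \<open>Applying \<open>r\<close> moves both vectors into the generalized eigenspace of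
    \<open>l\<close>: \<open>n ^ Suc k * r\<close> equals \<open>n * q\<close>, which kills
    \<open>W \<inter> Vp\<close>.\<close>
  define e where "e = pv r x"
  define f where "f = pv r y"
  have ef: "e \<in> W \<inter> Vp" "f \<in> W \<inter> Vp" using x y W(1) by (auto simp: e_def f_def invariant_pv Vp_pv)
  have nn: "n ^ Suc k * r = n * q" using r(1) unfolding k_def by (simp only: power_Suc mult.assoc)
  have 1: "pv (n ^ Suc k) e = 0\<^sub>v d" "pv (n ^ Suc k) f = 0\<^sub>v d"
    unfolding e_def f_def pv_mult[OF xV, symmetric] pv_mult[OF yV, symmetric] nn
    using kill x y by auto
  have "h (J e) (pv (n ^ k) f) = h (pv (n ^ k) (J e)) (pv r y)"
    using h_pv[of "J e" f "n ^ k"] xV yV by (simp add: e_def f_def)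
  also have "pv (n ^ k) (J e) = J z"
    using xV r(1) unfolding e_def z_def k_def by (metis pv_J pv_closed pv_mult)
  also have "h (J z) (pv r y) = h (J (pv r z)) y"
    using h_pv[of "J z" y r] zV yV by (simp add: pv_J)
  also have "\<dots> = complex_of_real (poly r l) * h (J z) y"
    using zV yV by (simp add: pv_eigen[OF zV nz] J_smult h_smult_left)
  finally have "h (J e) (pv (n ^ k) f) \<noteq> 0" using rl y by simp
  moreover have "l < 0" using ls by (simp add: P_def l)
  ultimately show ?thesis using ef 1 unfolding n_def by blast
qed

text \<open>A triangular elimination from the highest power downwards. The start scales
  \<open>f\<close> so that power \<open>k\<close> gives 1, higher powers being zero; each step
  removes the product at one further power, and with \<open>j = k\<close> the vector pairs with the
  whole chain of \<open>e\<close> as a dual basis does.\<close>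

lemma dual_chain_normalize:
  assumes W: "invariant W" and e: "e \<in> W \<inter> Vp" and f: "f \<in> W \<inter> Vp"
    and kf: "pv (n ^ Suc k) f = 0\<^sub>v d" and ne: "h (J e) (pv (n ^ k) f) \<noteq> 0" and "j \<le> k"
  shows "\<exists>g \<in> W \<inter> Vp. pv (n ^ Suc k) g = 0\<^sub>v d \<and>
    (\<forall>t. t + j \<ge> k \<longrightarrow> h (J e) (pv (n ^ t) g) = (if t = k then 1 else 0))"
  using \<open>j \<le> k\<close>
proof (induction j)
  case 0
  let ?c = "inverse (h (J e) (pv (n ^ k) f))"
  have V: "e \<in> V" "f \<in> V" using e f Vp_V by auto
  have z: "pv (n ^ t) f = 0\<^sub>v d" if "t > k" for t
  proof -
    have "n ^ t = n ^ (t - Suc k) * n ^ Suc k" using that by (metis Suc_leI le_add_diff_inverse2 power_add)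
    thus ?thesis using pv_mult[OF V(2)] kf by simp
  qed
  show ?case
  proof (intro bexI[of _ "?c \<cdot>\<^sub>v f"] conjI allI impI)
    show "?c \<cdot>\<^sub>v f \<in> W \<inter> Vp" using f W by (auto simp: invariant_def Vp_smult)
    show "pv (n ^ Suc k) (?c \<cdot>\<^sub>v f) = 0\<^sub>v d" using V kf by (simp add: pv_vec_smult del: power_Suc)
    fix t assume t: "t + 0 \<ge> k"
    show "h (J e) (pv (n ^ t) (?c \<cdot>\<^sub>v f)) = (if t = k then 1 else 0)"
      using t z[of t] V ne by (cases "t = k") (auto simp: pv_vec_smult h_smult_right)
  qed
next
  case (Suc j)
  then obtain g where g: "g \<in> W \<inter> Vp" "pv (n ^ Suc k) g = 0\<^sub>v d"
    "\<And>t. t + j \<ge> k \<Longrightarrow> h (J e) (pv (n ^ t) g) = (if t = k then 1 else 0)" by auto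
  have V: "e \<in> V" "g \<in> V" using e g Vp_V by auto
  \<comment> \<open>Power \<open>k - Suc j\<close> of the subtracted vector \<open>n ^ Suc j\<close>
    applied to \<open>g\<close> is power \<open>k\<close>, where the product is 1, so exactly
    \<open>c\<close> is removed. At every larger power the correction involves a power beyond
    \<open>k\<close> and vanishes.\<close>
  define c where "c = h (J e) (pv (n ^ (k - Suc j)) g)"
  define g' where "g' = g + (- c) \<cdot>\<^sub>v pv (n ^ Suc j) g"
  have g': "g' \<in> W \<inter> Vp" using g W unfolding g'_def
    by (auto simp: invariant_pv Vp_pv Vp_add Vp_smult) (auto simp: invariant_def invariant_pv[OF W])
  have pg': "pv p g' = pv p g + (- c) \<cdot>\<^sub>v pv (p * n ^ Suc j) g" for p
    unfolding g'_def using V by (simp add: pv_vec_add pv_vec_smult pv_mult del: power_Suc)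
  have "pv (n ^ Suc k) g' = 0\<^sub>v d"
  proof -
    have "pv (n ^ Suc k * n ^ Suc j) g = pv (n ^ Suc j) (pv (n ^ Suc k) g)"
      using pv_mult[OF V(2), of "n ^ Suc j" "n ^ Suc k"] by (simp only: mult.commute)
    thus ?thesis unfolding pg' g(2) by (simp del: power_Suc)
  qed
  moreover have "h (J e) (pv (n ^ t) g') = (if t = k then 1 else 0)" if t: "t + Suc j \<ge> k" for t
  proof -
    have "h (J e) (pv (n ^ t) g') = h (J e) (pv (n ^ t) g) - c * h (J e) (pv (n ^ (t + Suc j)) g)"
      unfolding pg' power_add[symmetric] using V by (simp add: h_add_right h_smult_right del: power_Suc)
    moreover have "h (J e) (pv (n ^ (t + Suc j)) g) = (if t + Suc j = k then 1 else 0)"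
      by (rule g(3)) (use t in simp)
    moreover have "h (J e) (pv (n ^ t) g) = (if t = k then 1 else 0)" if "t + Suc j \<noteq> k"
      by (rule g(3)) (use t that in simp)
    moreover have "h (J e) (pv (n ^ t) g) = c" if "t + Suc j = k" using that by (auto simp: c_def)
    ultimately show ?thesis by auto
  qed
  ultimately show ?case using g' by blast
qed

text \<open>\<open>u\<close> and \<open>v\<close> are the tops of two chains of length
  \<open>Suc k\<close>. As the nilpotent part is selfadjoint, powers on the right argument determine
  all products between chain vectors. The two relations for \<open>K\<close> make the span of both
  chains invariant.\<close>

definition chain_pair :: "real \<Rightarrow> nat \<Rightarrow> complex vec \<Rightarrow> complex vec \<Rightarrow> bool" where
  "chain_pair l k u v \<longleftrightarrow> u \<in> V \<and> v \<in> V \<and> K *\<^sub>v u = \<i> \<cdot>\<^sub>v v \<and> K *\<^sub>v v = \<i> \<cdot>\<^sub>v u \<and>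
     pv ([:- l, 1:] ^ Suc k) u = 0\<^sub>v d \<and> pv ([:- l, 1:] ^ Suc k) v = 0\<^sub>v d \<and>
     (\<forall>t. h u (pv ([:- l, 1:] ^ t) u) = (if t = k then 1 else 0) \<and>
          h v (pv ([:- l, 1:] ^ t) v) = (if t = k then - 1 else 0) \<and>
          h u (pv ([:- l, 1:] ^ t) v) = 0 \<and>
          h (J u) (pv ([:- l, 1:] ^ t) u) = 0 \<and> h (J u) (pv ([:- l, 1:] ^ t) v) = 0 \<and>
          h (J v) (pv ([:- l, 1:] ^ t) u) = 0 \<and> h (J v) (pv ([:- l, 1:] ^ t) v) = 0)"

lemma chain_pair_exists:
  assumes W: "invariant W" "nondegenerate W" and w: "w \<in> W" "w \<noteq> 0\<^sub>v d"
  shows "\<exists>l k u v. l < 0 \<and> u \<in> W \<and> v \<in> W \<and> chain_pair l k u v"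
proof -
  obtain l k e f0 where l: "l < 0" and e: "e \<in> W \<inter> Vp" and f0: "f0 \<in> W \<inter> Vp"
    "pv ([:- l, 1:] ^ Suc k) f0 = 0\<^sub>v d" "h (J e) (pv ([:- l, 1:] ^ k) f0) \<noteq> 0"
    and ke: "pv ([:- l, 1:] ^ Suc k) e = 0\<^sub>v d"
    using dual_chain_tops[OF W w] by blast
  define n where "n = [:- l, 1:]"
  obtain f where f: "f \<in> W \<inter> Vp" "pv (n ^ Suc k) f = 0\<^sub>v d"
    and ef: "\<And>t. h (J e) (pv (n ^ t) f) = (if t = k then 1 else 0)"
    using dual_chain_normalize[OF W(1) e f0, of k] unfolding n_def by auto
  have V: "e \<in> V" "f \<in> V" and P: "e \<in> Vp" "f \<in> Vp" using e f Vp_V by auto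
  \<comment> \<open>Skewness of the symplectic form and selfadjointness of \<open>p(B)\<close> make
    this number its own negative. Hence a single chain cannot pair with its own \<open>J\<close>
    image.\<close>
  have self0: "h (J x) (pv p x) = 0" if "x \<in> V" for x p
  proof -
    have "h (J x) (pv p x) = - h (J (pv p x)) x" using that by (intro h_J_skew) auto
    also have "h (J (pv p x)) x = h (J x) (pv p x)" using that h_pv[of "J x" x p] by (simp add: pv_J)
    finally show ?thesis by simp
  qed
  define u where "u a = e + complex_of_real a \<cdot>\<^sub>v J f" for a
  have uV: "u a \<in> V" for a using V by (simp add: u_def)
  have uW: "u a \<in> W" for a using W(1) e f by (auto simp: invariant_def u_def)
  have pu: "pv p (u a) = pv p e + complex_of_real a \<cdot>\<^sub>v J (pv p f)" for p a
    using V by (simp add: u_def pv_vec_add pv_vec_smult pv_J)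
  have Ju: "J (u a) = J e + complex_of_real (- a) \<cdot>\<^sub>v f" for a
    using V by (simp add: u_def J_add J_smult J_J smult_smult_assoc)
  have fe: "h (J (pv p f)) e = - h (J e) (pv p f)" for p using V by (intro h_J_skew) auto
  have fe': "h (J f) (pv p e) = - h (J e) (pv p f)" for p
    using h_J_skew[of f "pv p e"] h_pv[of "J e" f p] V by (simp add: pv_J)
  \<comment> \<open>The terms inside \<open>Vp\<close> and inside its \<open>J\<close> image vanish
    by isotropy, leaving the two mixed terms. Opposite parameters are thus orthogonal, and
    \<open>a = b\<close> gives \<open>- 2 a\<close>.\<close>
  have uu: "h (u a) (pv (n ^ t) (u b)) = (if t = k then - complex_of_real (a + b) else 0)" for a b t
  proof -
    have "h (u a) (pv (n ^ t) (u b)) = h e (pv (n ^ t) e) + complex_of_real b * h e (J (pv (n ^ t) f))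
        + (complex_of_real a * h (J f) (pv (n ^ t) e) + complex_of_real a * (complex_of_real b * h (J f) (J (pv (n ^ t) f))))"
      unfolding pu u_def[of a] using V
      by (simp add: h_add_left h_add_right h_smult_left h_smult_right algebra_simps)
    also have "h e (pv (n ^ t) e) = 0" using P by (intro Vp_isotropic Vp_pv)
    also have "h (J f) (J (pv (n ^ t) f)) = 0" using h_J[of f "pv (n ^ t) f"] V P Vp_isotropic[of f "pv (n ^ t) f"] Vp_pv by simp
    also have "h e (J (pv (n ^ t) f)) = cnj (h (J (pv (n ^ t) f)) e)" using V by (intro h_sym) auto
    finally show ?thesis by (cases "t = k") (simp_all add: fe fe' ef)
  qed
  have Juu: "h (J (u a)) (pv p (u b)) = 0" for a b p
  proof -
    have "h (J (u a)) (pv p (u b)) = h (J e) (pv p e) + complex_of_real b * h (J e) (J (pv p f))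
        + (complex_of_real (- a) * h f (pv p e) + complex_of_real (- a) * (complex_of_real b * h f (J (pv p f))))"
      unfolding pu Ju using V
      by (simp add: h_add_left h_add_right h_smult_left h_smult_right algebra_simps)
    also have "h (J e) (pv p e) = 0" using V by (intro self0)
    also have "h (J e) (J (pv p f)) = 0" using h_J[of e "pv p f"] V P Vp_isotropic[of e "pv p f"] Vp_pv by simp
    also have "h f (pv p e) = 0" using P by (intro Vp_isotropic Vp_pv)
    also have "h f (J (pv p f)) = cnj (h (J (pv p f)) f)" using V by (intro h_sym) auto
    also have "h (J (pv p f)) f = 0" using self0[OF V(2), of p] h_pv[of "J f" f p] V by (simp add: pv_J)
    finally show ?thesis by simp
  qed
  have kill: "pv (n ^ Suc k) (u a) = 0\<^sub>v d" for a
    unfolding pu f(2) using ke unfolding n_def by (simp del: power_Suc)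
  \<comment> \<open>\<open>K\<close> multiplies \<open>e\<close> by i and \<open>J f\<close> by -i,
    so it reverses the relative sign of the two summands.\<close>
  have Ku: "K *\<^sub>v u a = \<i> \<cdot>\<^sub>v u (- a)" for a
  proof -
    have "K *\<^sub>v u a = \<i> \<cdot>\<^sub>v e + complex_of_real a \<cdot>\<^sub>v J (\<i> \<cdot>\<^sub>v f)"
      unfolding u_def using V P by (simp add: mv_add mv_smult K_J Vp_def)
    also have "J (\<i> \<cdot>\<^sub>v f) = (- \<i>) \<cdot>\<^sub>v J f" using V by (simp add: J_smult)
    finally show ?thesis unfolding u_def using V by (simp only:) (auto intro!: eq_vecI simp: algebra_simps)
  qed
  have "chain_pair l k (u (- 1 / 2)) (u (1 / 2))"
    unfolding chain_pair_def n_def[symmetric]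
    using uV kill Ku[of "- 1 / 2"] Ku[of "1 / 2"] by (simp add: uu Juu)
  thus ?thesis using l uW by blast
qed

end

section \<open>Block matrices\<close>

definition hcat :: "'a mat \<Rightarrow> 'a mat \<Rightarrow> 'a mat" where
  "hcat X Y = mat (dim_row X) (dim_col X + dim_col Y)
     (\<lambda>(i, j). if j < dim_col X then X $$ (i, j) else Y $$ (i, j - dim_col X))"

lemma hcat_dim [simp]: "dim_row (hcat X Y) = dim_row X" "dim_col (hcat X Y) = dim_col X + dim_col Y"
  by (simp_all add: hcat_def)

lemma hcat_carrier [simp]:
  "X \<in> carrier_mat r a \<Longrightarrow> Y \<in> carrier_mat r b \<Longrightarrow> hcat X Y \<in> carrier_mat r (a + b)"
  by (intro carrier_matI) auto

lemma col_hcat: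
  "X \<in> carrier_mat r a \<Longrightarrow> Y \<in> carrier_mat r b \<Longrightarrow> j < a + b \<Longrightarrow>
     col (hcat X Y) j = (if j < a then col X j else col Y (j - a))"
  by (intro eq_vecI) (auto simp: hcat_def)

lemma mult_hcat:
  assumes "M \<in> carrier_mat r' r" "X \<in> carrier_mat r a" "Y \<in> carrier_mat r b"
  shows "M * hcat X Y = hcat (M * X) (M * Y)"
proof (rule eq_matI)
  fix i j assume "i < dim_row (hcat (M * X) (M * Y))" "j < dim_col (hcat (M * X) (M * Y))"
  hence "i < r'" "j < a + b" using assms by auto
  thus "(M * hcat X Y) $$ (i, j) = hcat (M * X) (M * Y) $$ (i, j)"
    using assms col_hcat[OF assms(2,3), of j] by (simp add: hcat_def[of "M * X"])
qed (use assms in auto)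

lemma hcat_mult_diag:
  assumes X: "X \<in> carrier_mat r a" and Y: "Y \<in> carrier_mat r b"
    and A: "A \<in> carrier_mat a a'" and D: "D \<in> carrier_mat b b'"
  shows "hcat X Y * four_block_mat A (0\<^sub>m a b') (0\<^sub>m b a') D = hcat (X * A) (Y * (D :: complex mat))"
proof (rule eq_matI)
  fix i j assume "i < dim_row (hcat (X * A) (Y * D))" "j < dim_col (hcat (X * A) (Y * D))"
  hence ij: "i < r" "j < a' + b'" using assms by auto
  let ?F = "four_block_mat A (0\<^sub>m a b') (0\<^sub>m b a') D"
  have row: "row (hcat X Y) i = row X i @\<^sub>v row Y i"
    using X Y ij by (intro eq_vecI) (auto simp: hcat_def)
  have e: "(hcat X Y * ?F) $$ (i, j) = row (hcat X Y) i \<bullet> col ?F j"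
    using assms ij by simp
  note c = col_four_block_mat[OF A zero_carrier_mat[of a b'] zero_carrier_mat[of b a'] D]
  show "(hcat X Y * ?F) $$ (i, j) = hcat (X * A) (Y * D) $$ (i, j)"
  proof (cases "j < a'")
    case True
    have "row (hcat X Y) i \<bullet> col ?F j = row X i \<bullet> col A j + row Y i \<bullet> col (0\<^sub>m b a') j"
      unfolding row c(1)[OF True]
      by (rule scalar_prod_append[of _ a _ b]) (use assms ij True in auto)
    thus ?thesis unfolding e using assms ij True by (simp add: hcat_def)
  next
    case False
    have "row (hcat X Y) i \<bullet> col ?F j = row X i \<bullet> col (0\<^sub>m a b') (j - a') + row Y i \<bullet> col D (j - a')"
      unfolding row c(2)[OF False ij(2)]
      by (rule scalar_prod_append[of _ a _ b]) (use assms ij False in auto)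
    thus ?thesis unfolding e using assms ij False by (simp add: hcat_def)
  qed
qed (use assms in auto)

text \<open>Otherwise padding with zeros gives square matrices that are inverse to each other on one side only.\<close>

lemma left_inverse_dim_le:
  assumes S: "S \<in> carrier_mat a b" and X: "X \<in> carrier_mat b a" and XS: "X * S = (1\<^sub>m b :: complex mat)"
  shows "b \<le> a"
proof (rule ccontr)
  assume "\<not> b \<le> a"
  hence ab: "a < b" by simp
  define S' where "S' = mat b b (\<lambda>(i, j). if i < a then S $$ (i, j) else 0)"
  define X' where "X' = mat b b (\<lambda>(i, j). if j < a then X $$ (i, j) else 0)"
  have "X' * S' = X * S"
  proof (rule eq_matI)
    fix i j assume "i < dim_row (X * S)" "j < dim_col (X * S)"
    hence ij: "i < b" "j < b" using S X by auto
    have "(X' * S') $$ (i, j) = (\<Sum>t = 0..<b. if t < a then X $$ (i, t) * S $$ (t, j) else 0)"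
      using ij by (simp add: X'_def S'_def scalar_prod_def) (intro sum.cong; simp)
    also have "\<dots> = (\<Sum>t = 0..<a. X $$ (i, t) * S $$ (t, j))"
      using ab by (intro sum.mono_neutral_cong_right) auto
    also have "\<dots> = (X * S) $$ (i, j)" using ij S X by (simp add: scalar_prod_def)
    finally show "(X' * S') $$ (i, j) = (X * S) $$ (i, j)" .
  qed (use S X in \<open>auto simp: X'_def S'_def\<close>)
  hence "S' * X' = 1\<^sub>m b"
    using XS mat_mult_left_right_inverse[of X' b S'] by (simp add: X'_def S'_def)
  moreover have "(S' * X') $$ (a, a) = 0"
    using ab by (simp add: X'_def S'_def scalar_prod_def)
  ultimately show False using ab by simp
qed

section \<open>Sign matrices, Jordan matrices and block diagonal sums\<close>

lemma Q_mat_carrier [simp]: "Q_mat k \<in> carrier_mat k k"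
  by (simp add: Q_mat_def)

lemma Q_mat_dim [simp]: "dim_row (Q_mat k) = k" "dim_col (Q_mat k) = k"
  by (simp_all add: Q_mat_def)

lemma Q_mat_square: "Q_mat k * Q_mat k = 1\<^sub>m k"
proof (rule eq_matI)
  fix i j assume "i < dim_row (1\<^sub>m k :: complex mat)" "j < dim_col (1\<^sub>m k :: complex mat)"
  hence ij: "i < k" "j < k" by auto
  have "(Q_mat k * Q_mat k) $$ (i, j) =
      (\<Sum>t = 0..<k. (if i + t = k - 1 then 1 else 0) * (if t + j = k - 1 then 1 else 0))"
    using ij by (simp add: Q_mat_def scalar_prod_def)
  also have "\<dots> = (\<Sum>t = 0..<k. if t = k - 1 - i then (if i = j then 1 else 0) else 0)"
    using ij by (intro sum.cong) auto
  also have "\<dots> = (if i = j then 1 else 0)" using ij by (subst sum.delta) auto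
  finally show "(Q_mat k * Q_mat k) $$ (i, j) = 1\<^sub>m k $$ (i, j)" using ij by simp
qed auto

text \<open>Every entry of the list stands for two blocks of size \<open>k\<close>. The canonical
  form uses the list twice and so has size \<open>bsize ps + bsize ps\<close>.\<close>

definition bsize :: "(nat \<times> real) list \<Rightarrow> nat" where
  "bsize ps = sum_list (map (\<lambda>(k, l). k + k) ps)"

lemma bsize_simps [simp]: "bsize [] = 0" "bsize ((k, l) # ps) = k + (k + bsize ps)"
  by (simp_all add: bsize_def)

definition diag2 :: "complex mat \<Rightarrow> complex mat \<Rightarrow> complex mat" where
  "diag2 A D = four_block_mat A (0\<^sub>m (dim_row A) (dim_col D)) (0\<^sub>m (dim_row D) (dim_col A)) D"

lemma diag2_carrier [simp]:
  "A \<in> carrier_mat a a' \<Longrightarrow> D \<in> carrier_mat b b' \<Longrightarrow> diag2 A D \<in> carrier_mat (a + b) (a' + b')"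
  by (simp add: diag2_def)

lemma hcat_mult_diag2:
  assumes "X \<in> carrier_mat r a" "Y \<in> carrier_mat r b" "A \<in> carrier_mat a a" "D \<in> carrier_mat b b"
  shows "hcat X Y * diag2 A D = hcat (X * A) (Y * D)"
  using hcat_mult_diag[OF assms] assms by (simp add: diag2_def)

lemma diag2_mult:
  assumes "A \<in> carrier_mat a a" "A' \<in> carrier_mat a a" "D \<in> carrier_mat b b" "D' \<in> carrier_mat b b"
  shows "diag2 A D * diag2 A' D' = diag2 (A * A') (D * D')"
  unfolding diag2_def using assms
  by (subst mult_four_block_mat[of _ a a _ b _ b _ _ a _ b]) auto

lemma diag2_one: "diag2 (1\<^sub>m a) (1\<^sub>m b) = 1\<^sub>m (a + b)"
  by (simp add: diag2_def)

lemma diag2_adjoint: "mat_adjoint (diag2 A D) = diag2 (mat_adjoint A) (mat_adjoint D)"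
  unfolding diag2_def by (rule eq_matI) auto

definition D_mat :: "(nat \<times> real) list \<Rightarrow> complex mat" where
  "D_mat ps = diag_block_mat (jordan_part ps)"

definition Qs_mat :: "(nat \<times> real) list \<Rightarrow> complex mat" where
  "Qs_mat ps = diag_block_mat (Q_part ps)"

lemma diag_block_mat_Cons: "diag_block_mat (A # As) = diag2 A (diag_block_mat As)"
  by (simp add: diag2_def Let_def)

lemma diag_block_mat_append2: "diag_block_mat (As @ Bs) = diag2 (diag_block_mat As) (diag_block_mat Bs)"
  by (simp add: diag2_def diag_block_mat_append Let_def)

text \<open>Both sides are the block diagonal sum of the list \<open>[A, B, C]\<close>, split at
  different places.\<close>

lemma diag2_assoc: "diag2 A (diag2 B C) = diag2 (diag2 A B) C"
proof -
  have "diag2 X (diag_block_mat []) = X" for X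
    by (simp only: diag_block_mat_Cons[symmetric] diag_block_mat_singleton)
  thus ?thesis using diag_block_mat_append2[of "[A, B]" "[C]"]
    by (simp only: append.simps diag_block_mat_Cons)
qed

lemma D_mat_simps: "D_mat [] = 0\<^sub>m 0 0"
  "D_mat ((k, l) # ps) = diag2 (jordan_block k (complex_of_real l)) (diag2 (jordan_block k (complex_of_real l)) (D_mat ps))"
  by (simp_all add: D_mat_def jordan_part_def diag_block_mat_Cons del: diag_block_mat.simps(2))

lemma Qs_mat_simps: "Qs_mat [] = 0\<^sub>m 0 0"
  "Qs_mat ((k, l) # ps) = diag2 (Q_mat k) (diag2 (- Q_mat k) (Qs_mat ps))"
  by (simp_all add: Qs_mat_def Q_part_def diag_block_mat_Cons del: diag_block_mat.simps(2))

lemma D_mat_carrier [simp]: "D_mat ps \<in> carrier_mat (bsize ps) (bsize ps)"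
  by (induction ps) (auto simp: D_mat_simps)

lemma Qs_mat_carrier [simp]: "Qs_mat ps \<in> carrier_mat (bsize ps) (bsize ps)"
  by (induction ps) (auto simp: Qs_mat_simps)

text \<open>The Gram matrix of a frame is its own inverse, which later gives orthogonal projections
  and left inverses explicitly.\<close>

lemma Qs_mat_square: "Qs_mat ps * Qs_mat ps = 1\<^sub>m (bsize ps)"
proof (induction ps)
  case Nil
  show ?case by (auto simp: Qs_mat_simps)
next
  case (Cons p ps)
  obtain k l where p: "p = (k, l)" by (cases p)
  have u: "- Q_mat k * - Q_mat k = 1\<^sub>m k" by (simp add: Q_mat_square)
  have "diag2 (- Q_mat k) (Qs_mat ps) * diag2 (- Q_mat k) (Qs_mat ps) = 1\<^sub>m (k + bsize ps)"
    by (subst diag2_mult[of _ k _ _ "bsize ps"]) (simp_all only: u Cons.IH diag2_one, auto)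
  moreover have "diag2 (- Q_mat k) (Qs_mat ps) \<in> carrier_mat (k + bsize ps) (k + bsize ps)" by simp
  ultimately show ?case unfolding p Qs_mat_simps
    by (subst diag2_mult[of _ k _ _ "k + bsize ps"]) (auto simp: Q_mat_square diag2_one simp del: diag2_carrier)
qed

text \<open>The blocks belong to real eigenvalues. Conjugating a chain relation
  \<open>B * U = U * D_mat ps\<close> therefore leaves the Jordan matrix alone, and the images of
  the columns under \<open>J\<close> satisfy the same relation.\<close>

lemma D_mat_real: "map_mat cnj (D_mat ps) = D_mat ps"
proof (induction ps)
  case (Cons p ps)
  obtain k l where p: "p = (k, l)" by (cases p)
  have d: "map_mat cnj (diag2 A D) = diag2 (map_mat cnj A) (map_mat cnj D)" for A D
    unfolding diag2_def by (rule eq_matI) auto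
  have "map_mat cnj (jordan_block k (complex_of_real l)) = jordan_block k (complex_of_real l)"
    by (rule eq_matI) (auto simp: jordan_block_def)
  thus ?case by (simp add: p D_mat_simps d Cons.IH)
qed (auto simp: D_mat_simps)

lemma Qs_mat_real: "map_mat cnj (Qs_mat ps) = Qs_mat ps"
proof (induction ps)
  case (Cons p ps)
  obtain k l where p: "p = (k, l)" by (cases p)
  have d: "map_mat cnj (diag2 A D) = diag2 (map_mat cnj A) (map_mat cnj D)" for A D
    unfolding diag2_def by (rule eq_matI) auto
  have "map_mat cnj (Q_mat k) = Q_mat k" "map_mat cnj (- Q_mat k) = - Q_mat k"
    by (auto simp: Q_mat_def intro!: eq_matI)
  thus ?case by (simp add: p Qs_mat_simps d Cons.IH)
qed (auto simp: Qs_mat_simps)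

section \<open>Frames\<close>

context quat_complex_structure
begin

definition gram :: "complex mat \<Rightarrow> complex mat \<Rightarrow> complex mat" where
  "gram X Y = mat (dim_col X) (dim_col Y) (\<lambda>(i, j). h (col X i) (col Y j))"

lemma gram_dim [simp]: "dim_row (gram X Y) = dim_col X" "dim_col (gram X Y) = dim_col Y"
  by (simp_all add: gram_def)

lemma mat_adjoint_mv:
  assumes "X \<in> carrier_mat d a" "z \<in> V" "i < a"
  shows "(mat_adjoint X *\<^sub>v z) $ i = z \<bullet>c col X i"
  using assms by (auto simp: scalar_prod_def mult.commute intro!: sum.cong)

lemma gram_eq:
  assumes X: "X \<in> carrier_mat d a" and Y: "Y \<in> carrier_mat d b"
  shows "mat_adjoint X * H * Y = gram X Y"
proof (rule eq_matI)
  fix i j assume "i < dim_row (gram X Y)" "j < dim_col (gram X Y)"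
  hence ij: "i < a" "j < b" using X Y by auto
  have "mat_adjoint X * H * Y = mat_adjoint X * (H * Y)"
    by (rule assoc_mult_mat[of _ a d _ d _ b]) (use X Y in auto)
  also have "\<dots> $$ (i, j) = (mat_adjoint X *\<^sub>v col (H * Y) j) $ i"
    using ij X Y by simp
  also have "col (H * Y) j = H *\<^sub>v col Y j" using ij Y by (simp add: col_mult2[of H d d Y b])
  also have "(mat_adjoint X *\<^sub>v (H *\<^sub>v col Y j)) $ i = h (col X i) (col Y j)"
    unfolding h_def by (rule mat_adjoint_mv) (use X Y ij in auto)
  finally show "(mat_adjoint X * H * Y) $$ (i, j) = gram X Y $$ (i, j)"
    using ij X Y by (simp add: gram_def)
qed (use X Y in auto)

lemma gram_hcat:
  assumes "X \<in> carrier_mat d a" "Y \<in> carrier_mat d b"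
    and "\<And>i j. i < a \<Longrightarrow> j < b \<Longrightarrow> h (col X i) (col Y j) = 0"
  shows "gram (hcat X Y) (hcat X Y) = diag2 (gram X X) (gram Y Y)"
proof (rule eq_matI)
  fix i j assume "i < dim_row (diag2 (gram X X) (gram Y Y))" "j < dim_col (diag2 (gram X X) (gram Y Y))"
  hence ij: "i < a + b" "j < a + b" using assms by (auto simp: diag2_def)
  have s: "h (col Y j) (col X i) = 0" if "i < a" "j < b" for i j
    using h_sym[of "col X i" "col Y j"] assms that by simp
  show "gram (hcat X Y) (hcat X Y) $$ (i, j) = diag2 (gram X X) (gram Y Y) $$ (i, j)"
    using ij assms s[of j "i - a"] assms(3)[of i "j - a"] 
    by (simp add: gram_def diag2_def col_hcat[OF assms(1,2)])
qed (use assms in \<open>auto simp: diag2_def\<close>)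

definition cset :: "complex mat \<Rightarrow> complex vec set" where "cset X = col X ` {..<dim_col X}"

lemma cset_hcat:
  assumes "X \<in> carrier_mat r a" "Y \<in> carrier_mat r b"
  shows "cset (hcat X Y) = cset X \<union> cset Y"
proof -
  have "{..<a + b} = {..<a} \<union> (\<lambda>j. a + j) ` {..<b}" 
  proof (intro equalityI subsetI)
    fix j assume "j \<in> {..<a + b}"
    thus "j \<in> {..<a} \<union> (\<lambda>j. a + j) ` {..<b}"
      by (cases "j < a") (auto intro!: image_eqI[of _ _ "j - a"])
  qed auto
  hence "cset (hcat X Y) = col (hcat X Y) ` {..<a} \<union> (\<lambda>j. col (hcat X Y) (a + j)) ` {..<b}"
    using assms by (simp add: cset_def image_Un image_image)
  also have "col (hcat X Y) ` {..<a} = cset X"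
    unfolding cset_def using assms by (intro image_cong) (auto simp: col_hcat[OF assms])
  also have "(\<lambda>j. col (hcat X Y) (a + j)) ` {..<b} = cset Y"
    unfolding cset_def using assms by (intro image_cong) (auto simp: col_hcat[OF assms])
  finally show ?thesis .
qed

definition JM :: "complex mat \<Rightarrow> complex mat" where "JM U = quat_mat N * map_mat cnj U"

lemma JM_carrier [simp]: "U \<in> carrier_mat d r \<Longrightarrow> JM U \<in> carrier_mat d r"
  unfolding JM_def by (rule mult_carrier_mat[of _ d d]) auto

lemma col_JM: "U \<in> carrier_mat d r \<Longrightarrow> j < r \<Longrightarrow> col (JM U) j = J (col U j)"
proof -
  assume U: "U \<in> carrier_mat d r" and j: "j < r"
  have "col (JM U) j = quat_mat N *\<^sub>v col (map_mat cnj U) j"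
    unfolding JM_def by (rule col_mult2) (use U j in auto)
  also have "col (map_mat cnj U) j = conjugate (col U j)" using U j by (intro eq_vecI) auto
  finally show ?thesis by (simp add: J_def)
qed

text \<open>The orthogonal complement of the columns of U and of their images under J, which are the remaining
  columns of a matrix in Omega N starting with U.\<close>

definition perp :: "complex mat \<Rightarrow> complex vec set" where
  "perp U = {x \<in> V. \<forall>c \<in> cset U. h c x = 0 \<and> h (J c) x = 0}"

text \<open>The exponents decrease: column 0 is the bottom of the chain and column \<open>k\<close>
  its top \<open>u\<close>. This order matches upper triangular Jordan blocks.\<close>

definition chain :: "real \<Rightarrow> nat \<Rightarrow> complex vec \<Rightarrow> complex mat" where
  "chain l k u = mat d (Suc k) (\<lambda>(i, j). pv ([:- l, 1:] ^ (k - j)) u $ i)"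

lemma chain_carrier [simp]: "chain l k u \<in> carrier_mat d (Suc k)"
  by (simp add: chain_def)

lemma col_chain: "u \<in> V \<Longrightarrow> j < Suc k \<Longrightarrow> col (chain l k u) j = pv ([:- l, 1:] ^ (k - j)) u"
  by (intro eq_vecI) (auto simp: chain_def)

lemma cset_chain: "u \<in> V \<Longrightarrow> cset (chain l k u) = (\<lambda>i. pv ([:- l, 1:] ^ i) u) ` {..k}"
proof -
  assume u: "u \<in> V"
  have "cset (chain l k u) = (\<lambda>j. pv ([:- l, 1:] ^ (k - j)) u) ` {..k}"
    unfolding cset_def using u carrier_matD[OF chain_carrier, of l k u]
    by (intro image_cong) (auto simp: col_chain lessThan_Suc_atMost)
  also have "\<dots> = (\<lambda>i. pv ([:- l, 1:] ^ i) u) ` ((\<lambda>j. k - j) ` {..k})" by (simp add: image_image)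
  also have "(\<lambda>j. k - j) ` {..k} = {..k}" 
  proof (intro equalityI subsetI)
    fix j assume "j \<in> {..k}"
    thus "j \<in> (\<lambda>j. k - j) ` {..k}" by (auto intro!: image_eqI[of _ _ "k - j"])
  qed auto
  finally show ?thesis .
qed

lemma B_pv: "x \<in> V \<Longrightarrow> B *\<^sub>v x = pv [:- l, 1:] x + complex_of_real l \<cdot>\<^sub>v x"
  unfolding pv_def poly_mat_linear[OF carriers(2)]
  by (subst add_mult_distrib_mat_vec[of _ d d]) (auto intro!: eq_vecI simp del: index_mult_mat_vec)

text \<open>\<open>B\<close> is \<open>l\<close> plus the nilpotent part, which sends each column to
  the previous one and column 0 to zero by the second hypothesis.\<close>

lemma B_chain:
  assumes u: "u \<in> V" and k: "pv ([:- l, 1:] ^ Suc k) u = 0\<^sub>v d"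
  shows "B * chain l k u = chain l k u * jordan_block (Suc k) (complex_of_real l)"
proof (rule eq_matI)
  let ?n = "[:- l, 1:]" and ?E = "chain l k u" and ?J = "jordan_block (Suc k) (complex_of_real l)"
  fix i j assume "i < dim_row (?E * ?J)" "j < dim_col (?E * ?J)"
  hence ij: "i < d" "j < Suc k" by (auto simp: chain_def)
  let ?x = "pv (?n ^ (k - j)) u"
  have "(B * ?E) $$ (i, j) = (B *\<^sub>v col ?E j) $ i" using ij by (simp add: chain_def)
  also have "\<dots> = pv ?n ?x $ i + complex_of_real l * ?x $ i"
    using ij u
    unfolding col_chain[OF u ij(2)] by (subst B_pv[of _ l]) (auto simp: pv_closed)
  also have "pv ?n ?x = pv (?n ^ Suc (k - j)) u" by (simp only: pv_mult[OF u] power_Suc)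
  finally have L: "(B * ?E) $$ (i, j) = pv (?n ^ Suc (k - j)) u $ i + complex_of_real l * ?x $ i" .
  have "(?E * ?J) $$ (i, j) = (\<Sum>a = 0..<Suc k. pv (?n ^ (k - a)) u $ i * ?J $$ (a, j))"
    using ij by (simp add: chain_def scalar_prod_def del: sum.op_ivl_Suc)
  also have "\<dots> = (\<Sum>a = 0..<Suc k. (if a = j then complex_of_real l * ?x $ i else 0) +
      (if Suc a = j then pv (?n ^ (k - a)) u $ i else 0))"
    using ij by (intro sum.cong) (auto simp: jordan_block_def)
  also have "\<dots> = complex_of_real l * ?x $ i + (\<Sum>a = 0..<Suc k. if Suc a = j then pv (?n ^ (k - a)) u $ i else 0)"
    unfolding sum.distrib using ij by (subst sum.delta) auto
  also have "(\<Sum>a = 0..<Suc k. if Suc a = j then pv (?n ^ (k - a)) u $ i else 0) = pv (?n ^ Suc (k - j)) u $ i"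
  proof (cases j)
    case 0
    thus ?thesis using k ij by (simp del: power_Suc)
  next
    case (Suc j')
    have "(\<Sum>a = 0..<Suc k. if Suc a = j then pv (?n ^ (k - a)) u $ i else 0) =
        (\<Sum>a = 0..<Suc k. if a = j' then pv (?n ^ (k - a)) u $ i else 0)"
      by (intro sum.cong) (auto simp: Suc)
    also have "\<dots> = pv (?n ^ (k - j')) u $ i" using Suc ij by (subst sum.delta) auto
    also have "k - j' = Suc (k - j)" using Suc ij by simp
    finally show ?thesis .
  qed
  finally show "(B * ?E) $$ (i, j) = (?E * ?J) $$ (i, j)" using L by simp
qed (auto simp: chain_def)

text \<open>Selfadjointness lets the exponents add up to \<open>2 k - i - j\<close>, and this equals
  \<open>k\<close> exactly on the anti-diagonal \<open>i + j = k\<close> of a matrix of size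
  \<open>Suc k\<close>.\<close>

lemma gram_chain:
  assumes u: "u \<in> V" and k: "\<And>t. h u (pv ([:- l, 1:] ^ t) u) = (if t = k then c else 0)"
  shows "gram (chain l k u) (chain l k u) = c \<cdot>\<^sub>m Q_mat (Suc k)"
proof (rule eq_matI)
  let ?n = "[:- l, 1:]"
  fix i j assume "i < dim_row (c \<cdot>\<^sub>m Q_mat (Suc k))" "j < dim_col (c \<cdot>\<^sub>m Q_mat (Suc k))"
  hence ij: "i < Suc k" "j < Suc k" by (auto simp: Q_mat_def)
  have "gram (chain l k u) (chain l k u) $$ (i, j) = h (pv (?n ^ (k - i)) u) (pv (?n ^ (k - j)) u)"
    using ij carrier_matD[OF chain_carrier, of l k u] by (simp add: gram_def col_chain[OF u])
  also have "\<dots> = h u (pv (?n ^ (k - i + (k - j))) u)"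
    using u by (simp add: h_pv pv_mult power_add)
  also have "\<dots> = (if i + j = k then c else 0)" unfolding k using ij by auto
  finally show "gram (chain l k u) (chain l k u) $$ (i, j) = (c \<cdot>\<^sub>m Q_mat (Suc k)) $$ (i, j)"
    using ij by (simp add: Q_mat_def)
qed (auto simp: chain_def Q_mat_def)

text \<open>\<open>U\<close> is one half of a partial canonical basis, the other half being
  \<open>JM U\<close>; the condition on \<open>h (J x) y\<close> makes the halves orthogonal.
  Invariance of \<open>perp U\<close> is carried along because the next pair of chains is taken from
  there.\<close>

definition frame :: "(nat \<times> real) list \<Rightarrow> complex mat \<Rightarrow> bool" where
  "frame ps U \<longleftrightarrow> (\<forall>(k, l) \<in> set ps. k \<ge> 1 \<and> l < 0) \<and> U \<in> carrier_mat d (bsize ps) \<and>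
     B * U = U * D_mat ps \<and> gram U U = Qs_mat ps \<and>
     (\<forall>x \<in> cset U. \<forall>y \<in> cset U. h (J x) y = 0) \<and> invariant (perp U)"

lemma frame_Nil: "frame [] (0\<^sub>m d 0)"
proof -
  have "cset (0\<^sub>m d 0) = {}" by (simp add: cset_def)
  thus ?thesis by (auto simp: frame_def D_mat_simps Qs_mat_simps gram_def perp_def invariant_def intro!: eq_matI)
qed

lemma cset_V: "U \<in> carrier_mat d r \<Longrightarrow> c \<in> cset U \<Longrightarrow> c \<in> V"
  by (auto simp: cset_def)

lemma frame_extend:
  assumes F: "frame ps U" and l: "l < 0" and u: "u \<in> perp U" and v: "v \<in> perp U"
    and c: "chain_pair l k u v"
  shows "frame ((Suc k, l) # ps) (hcat (chain l k u) (hcat (chain l k v) U))"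
proof -
  let ?n = "[:- l, 1:]"
  define E where "E = chain l k u"
  define G where "G = chain l k v"
  have U: "U \<in> carrier_mat d (bsize ps)" and BU: "B * U = U * D_mat ps" and UU: "gram U U = Qs_mat ps"
    and iso: "\<And>x y. x \<in> cset U \<Longrightarrow> y \<in> cset U \<Longrightarrow> h (J x) y = 0" and inv: "invariant (perp U)"
    and ps: "\<forall>(k, l) \<in> set ps. k \<ge> 1 \<and> l < 0"
    using F by (auto simp: frame_def)
  have V: "u \<in> V" "v \<in> V" and Ku: "K *\<^sub>v u = \<i> \<cdot>\<^sub>v v" and Kv: "K *\<^sub>v v = \<i> \<cdot>\<^sub>v u"
    and ku: "pv (?n ^ Suc k) u = 0\<^sub>v d" and kv: "pv (?n ^ Suc k) v = 0\<^sub>v d"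
    and huu: "\<And>t. h u (pv (?n ^ t) u) = (if t = k then 1 else 0)"
    and hvv: "\<And>t. h v (pv (?n ^ t) v) = (if t = k then - 1 else 0)"
    and huv: "\<And>t. h u (pv (?n ^ t) v) = 0"
    and hJ: "\<And>t. h (J u) (pv (?n ^ t) u) = 0" "\<And>t. h (J u) (pv (?n ^ t) v) = 0"
      "\<And>t. h (J v) (pv (?n ^ t) u) = 0" "\<And>t. h (J v) (pv (?n ^ t) v) = 0"
    using c unfolding chain_pair_def by blast+
  have Ec: "E \<in> carrier_mat d (Suc k)" and Gc: "G \<in> carrier_mat d (Suc k)" by (simp_all add: E_def G_def)
  have GU: "hcat G U \<in> carrier_mat d (Suc k + bsize ps)" using Gc U by (rule hcat_carrier)
  have EGU: "hcat E (hcat G U) \<in> carrier_mat d (Suc k + (Suc k + bsize ps))" using Ec GU by (rule hcat_carrier)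
  have csE: "cset E = (\<lambda>i. pv (?n ^ i) u) ` {..k}" and csG: "cset G = (\<lambda>i. pv (?n ^ i) v) ` {..k}"
    unfolding E_def G_def using V by (simp_all add: cset_chain)
  have csGU: "cset (hcat G U) = cset G \<union> cset U" by (rule cset_hcat[OF Gc U])
  have cs: "cset (hcat E (hcat G U)) = cset E \<union> (cset G \<union> cset U)"
    unfolding csGU[symmetric] by (rule cset_hcat[OF Ec GU])
  have UV: "x \<in> V" if "x \<in> cset U" for x using cset_V[OF U that] .
  have perpE: "x \<in> perp U" if "x \<in> cset E \<union> cset G" for x
    using that u v inv unfolding csE csG by (auto intro: invariant_pv)
  have perpV: "x \<in> V" if "x \<in> perp U" for x using that by (simp add: perp_def)
  \<comment> \<open>\<open>perp\<close> speaks about old vectors on the left only; Hermitian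
    symmetry and skewness supply the reversed order.\<close>
  have new_old: "h y x = 0" "h (J y) x = 0" "h x y = 0" "h (J x) y = 0" if "x \<in> perp U" "y \<in> cset U" for x y
  proof -
    have xy: "x \<in> V" "y \<in> V" using perpV UV that by auto
    show 1: "h y x = 0" "h (J y) x = 0" using that by (auto simp: perp_def)
    show "h x y = 0" "h (J x) y = 0" using 1 h_sym[of y x] h_J_skew[of x y] xy by simp_all
  qed
  have hpp: "h (pv (?n ^ i) a) (pv (?n ^ j) b) = h a (pv (?n ^ (i + j)) b)" if "a \<in> V" "b \<in> V" for a b i j
    using that by (simp add: h_pv pv_mult power_add)
  have hJpp: "h (J (pv (?n ^ i) a)) (pv (?n ^ j) b) = h (J a) (pv (?n ^ (i + j)) b)" if "a \<in> V" "b \<in> V" for a b i j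
    using that hpp[of "J a" b i j] by (simp add: pv_J)
  have EG: "h x y = 0" if "x \<in> cset E" "y \<in> cset G" for x y
    using that V unfolding csE csG by (auto simp: hpp huv)
  have colc: "col X j \<in> cset X" if "X \<in> carrier_mat d r" "j < r" for X j and r :: nat
    using that by (auto simp: cset_def)

  have 1: "B * hcat E (hcat G U) = hcat E (hcat G U) * D_mat ((Suc k, l) # ps)"
  proof -
    let ?J = "jordan_block (Suc k) (complex_of_real l)"
    have "B * hcat E (hcat G U) = hcat (B * E) (hcat (B * G) (B * U))"
      by (simp only: mult_hcat[OF carriers(2) Ec GU] mult_hcat[OF carriers(2) Gc U])
    also have "\<dots> = hcat (E * ?J) (hcat (G * ?J) (U * D_mat ps))"
      unfolding E_def G_def B_chain[OF V(1) ku] B_chain[OF V(2) kv] BU ..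
    also have "\<dots> = hcat E (hcat G U) * D_mat ((Suc k, l) # ps)"
    proof -
      have J: "?J \<in> carrier_mat (Suc k) (Suc k)" by simp
      have D: "diag2 ?J (D_mat ps) \<in> carrier_mat (Suc k + bsize ps) (Suc k + bsize ps)"
        using J by (rule diag2_carrier) simp
      show ?thesis unfolding D_mat_simps hcat_mult_diag2[OF Ec GU J D] hcat_mult_diag2[OF Gc U J D_mat_carrier] ..
    qed
    finally show ?thesis .
  qed
  have 2: "gram (hcat E (hcat G U)) (hcat E (hcat G U)) = Qs_mat ((Suc k, l) # ps)"
  proof -
    have "gram (hcat E (hcat G U)) (hcat E (hcat G U)) = diag2 (gram E E) (gram (hcat G U) (hcat G U))"
    proof (rule gram_hcat[OF Ec GU])
      fix i j assume "i < Suc k" "j < Suc k + bsize ps"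
      hence "col E i \<in> cset E" "col (hcat G U) j \<in> cset G \<union> cset U"
        using colc[OF Ec] colc[OF GU] csGU by auto
      thus "h (col E i) (col (hcat G U) j) = 0" using EG new_old(3) perpE by blast
    qed
    also have "gram (hcat G U) (hcat G U) = diag2 (gram G G) (gram U U)"
    proof (rule gram_hcat[OF Gc U])
      fix i j assume "i < Suc k" "j < bsize ps"
      hence "col G i \<in> cset G" "col U j \<in> cset U"
        using colc[OF Gc] colc[OF U] by auto
      thus "h (col G i) (col U j) = 0" using new_old(3) perpE by blast
    qed
    also have "gram E E = Q_mat (Suc k)"
      unfolding E_def using gram_chain[OF V(1) huu] by (auto intro!: eq_matI)
    also have "gram G G = - Q_mat (Suc k)"
      unfolding G_def using gram_chain[OF V(2) hvv] by (auto intro!: eq_matI)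
    finally show ?thesis unfolding UU Qs_mat_simps .
  qed
  have 3: "h (J x) y = 0" if xy: "x \<in> cset E \<union> (cset G \<union> cset U)" "y \<in> cset E \<union> (cset G \<union> cset U)" for x y
  proof -
    have nn: "h (J x) y = 0" if "x \<in> cset E \<union> cset G" "y \<in> cset E \<union> cset G"
      using that V unfolding csE csG by (auto simp: hJpp hJ)
    consider "x \<in> cset U" "y \<in> cset U" | "x \<in> cset U" "y \<in> cset E \<union> cset G"
      | "x \<in> cset E \<union> cset G" "y \<in> cset U" | "x \<in> cset E \<union> cset G" "y \<in> cset E \<union> cset G"
      using xy by blast
    thus ?thesis using iso new_old perpE nn by cases auto
  qed
  \<comment> \<open>The complement of the whole cyclic space of \<open>c\<close>. Without a bound on
    the exponent, invariance under \<open>B\<close> needs no case for the end of the chain; by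
    \<open>zero\<close>, powers above \<open>k\<close> impose no condition.\<close>
  define pc where "pc c = {x \<in> V. \<forall>i. h (pv (?n ^ i) c) x = 0}" for c
  have zero: "pv (?n ^ i) a = 0\<^sub>v d" if "i > k" "a = u \<or> a = v" for i a
  proof -
    have "?n ^ i = ?n ^ (i - Suc k) * ?n ^ Suc k" using that(1) by (metis Suc_leI le_add_diff_inverse2 power_add)
    thus ?thesis using pv_mult[of a] V ku kv that(2) by auto
  qed
  have pc_iff: "x \<in> pc a \<and> x \<in> pc (J a) \<longleftrightarrow>
      x \<in> V \<and> (\<forall>c \<in> (\<lambda>i. pv (?n ^ i) a) ` {..k}. h c x = 0 \<and> h (J c) x = 0)" if a: "a = u \<or> a = v" for a x
  proof -
    have aV: "a \<in> V" using a V by auto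
    have "h (pv (?n ^ i) a) x = 0 \<and> h (J (pv (?n ^ i) a)) x = 0" if "i > k" "x \<in> V" for i
      using zero[OF that(1) a] that by simp
    hence "x \<in> V \<Longrightarrow> (\<forall>i. h (pv (?n ^ i) a) x = 0 \<and> h (J (pv (?n ^ i) a)) x = 0) \<longleftrightarrow>
      (\<forall>i \<le> k. h (pv (?n ^ i) a) x = 0 \<and> h (J (pv (?n ^ i) a)) x = 0)" by (meson not_le)
    thus ?thesis unfolding pc_def using aV by (auto simp: pv_J)
  qed
  \<comment> \<open>The four new complements are permuted by the structure: \<open>B\<close>
    preserves each of them, \<open>K\<close> exchanges \<open>u\<close> with \<open>v\<close> and
    \<open>J u\<close> with \<open>J v\<close>, and \<open>J\<close> exchanges \<open>u\<close> with
    \<open>J u\<close> and \<open>v\<close> with \<open>J v\<close>.\<close>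
  have perp': "perp (hcat E (hcat G U)) = perp U \<inter> (pc u \<inter> pc (J u)) \<inter> (pc v \<inter> pc (J v))"
  proof (rule Set.set_eqI)
    fix x
    have "x \<in> perp (hcat E (hcat G U)) \<longleftrightarrow> x \<in> perp U \<and>
       (x \<in> V \<and> (\<forall>c\<in>cset E. h c x = 0 \<and> h (J c) x = 0)) \<and>
       (x \<in> V \<and> (\<forall>c\<in>cset G. h c x = 0 \<and> h (J c) x = 0))"
      unfolding perp_def cs by blast
    thus "x \<in> perp (hcat E (hcat G U)) \<longleftrightarrow> x \<in> perp U \<inter> (pc u \<inter> pc (J u)) \<inter> (pc v \<inter> pc (J v))"
      using pc_iff[of u x] pc_iff[of v x] unfolding csE csG by blast
  qed
  have pc_lin: "x + y \<in> pc a" "b \<cdot>\<^sub>v x \<in> pc a" "B *\<^sub>v x \<in> pc a" if "x \<in> pc a" "y \<in> pc a" "a \<in> V" for x y a b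
  proof -
    have xy: "x \<in> V" "y \<in> V" using that by (auto simp: pc_def)
    show "x + y \<in> pc a" "b \<cdot>\<^sub>v x \<in> pc a" using that xy by (auto simp: pc_def h_add_right h_smult_right)
    have "h (pv (?n ^ i) a) (B *\<^sub>v x) = 0" for i
    proof -
      have "h (pv (?n ^ i) a) (B *\<^sub>v x) = h (pv (?n ^ i) a) (pv ?n x) + complex_of_real l * h (pv (?n ^ i) a) x"
        using xy that(3) by (simp add: B_pv[of x l] h_add_right h_smult_right)
      also have "h (pv (?n ^ i) a) (pv ?n x) = h (pv (?n ^ Suc i) a) x"
        using xy that(3) by (simp only: h_pv[symmetric] pv_mult power_Suc pv_closed)
      also have "h (pv (?n ^ Suc i) a) x = 0" using that(1) unfolding pc_def by blast
      also have "h (pv (?n ^ i) a) x = 0" using that(1) unfolding pc_def by blast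
      finally show ?thesis by simp
    qed
    thus "B *\<^sub>v x \<in> pc a" using xy by (simp add: pc_def)
  qed
  have pc_K: "K *\<^sub>v x \<in> pc a" if "x \<in> pc b" "a \<in> V" "b \<in> V" "K *\<^sub>v a = s \<cdot>\<^sub>v b" for x a b s
  proof -
    have x: "x \<in> V" using that by (auto simp: pc_def)
    have "h (pv (?n ^ i) a) (K *\<^sub>v x) = 0" for i
    proof -
      have "h (pv (?n ^ i) a) (K *\<^sub>v x) = h (pv (?n ^ i) (s \<cdot>\<^sub>v b)) x"
        using x that(2) by (simp add: h_K[symmetric] pv_K[symmetric] that(4))
      thus ?thesis using x that by (simp add: pv_vec_smult h_smult_left pc_def)
    qed
    thus ?thesis using x by (simp add: pc_def)
  qed
  have pc_J: "J x \<in> pc a" if "x \<in> pc (J a)" "a \<in> V" for x a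
  proof -
    have x: "x \<in> V" using that by (auto simp: pc_def)
    have "h (pv (?n ^ i) a) (J x) = 0" for i
    proof -
      have "cnj (h (pv (?n ^ i) a) (J x)) = h (J (pv (?n ^ i) a)) (J (J x))" using x that by (simp add: h_J)
      also have "\<dots> = 0" using x that by (simp add: J_J h_smult_right pc_def pv_J)
      finally show ?thesis by simp
    qed
    thus ?thesis using x by (simp add: pc_def)
  qed
  have pc_JJ: "pc (J (J a)) = pc a" if "a \<in> V" for a
    using that by (auto simp: pc_def J_J pv_vec_smult h_smult_left)
  have KJ: "K *\<^sub>v J u = (- \<i>) \<cdot>\<^sub>v J v" "K *\<^sub>v J v = (- \<i>) \<cdot>\<^sub>v J u"
    using V Ku Kv by (simp_all add: K_J J_smult)
  have 4: "invariant (perp (hcat E (hcat G U)))"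
    unfolding invariant_def
  proof (intro conjI ballI allI)
    show "perp (hcat E (hcat G U)) \<subseteq> V" by (auto simp: perp_def)
    fix x assume x: "x \<in> perp (hcat E (hcat G U))"
    hence x': "x \<in> perp U" "x \<in> pc u" "x \<in> pc v" "x \<in> pc (J u)" "x \<in> pc (J v)" unfolding perp' by auto
    {
      fix y assume "y \<in> perp (hcat E (hcat G U))"
      thus "x + y \<in> perp (hcat E (hcat G U))" using x' inv V unfolding perp'
        by (auto simp: invariant_def pc_lin)
    next
      fix b show "b \<cdot>\<^sub>v x \<in> perp (hcat E (hcat G U))" using x' inv V unfolding perp'
        by (auto simp: invariant_def pc_lin(2)[OF _ x'(2)] pc_lin(2)[OF _ x'(3)] pc_lin(2)[OF _ x'(4)] pc_lin(2)[OF _ x'(5)])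
    next
      show "B *\<^sub>v x \<in> perp (hcat E (hcat G U))" using x' inv V unfolding perp'
        by (auto simp: invariant_def pc_lin(3)[OF _ x'(2)] pc_lin(3)[OF _ x'(3)] pc_lin(3)[OF _ x'(4)] pc_lin(3)[OF _ x'(5)])
    next
      have "K *\<^sub>v x \<in> pc u" "K *\<^sub>v x \<in> pc v" using pc_K[OF x'(3) V Ku] pc_K[OF x'(2) V(2,1) Kv] by auto
      moreover have "K *\<^sub>v x \<in> pc (J u)" "K *\<^sub>v x \<in> pc (J v)"
        using pc_K[OF x'(5) _ _ KJ(1)] pc_K[OF x'(4) _ _ KJ(2)] V by auto
      ultimately show "K *\<^sub>v x \<in> perp (hcat E (hcat G U))" using x' inv unfolding perp'
        by (auto simp: invariant_def)
    next
      have "J x \<in> pc u" "J x \<in> pc v" using pc_J[OF x'(4) V(1)] pc_J[OF x'(5) V(2)] by auto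
      moreover have "J x \<in> pc (J u)" "J x \<in> pc (J v)"
        using pc_J[of x "J u"] pc_J[of x "J v"] x' V by (auto simp: pc_JJ)
      ultimately show "J x \<in> perp (hcat E (hcat G U))" using x' inv unfolding perp'
        by (auto simp: invariant_def)
    }
  qed
  show ?thesis unfolding frame_def E_def[symmetric] G_def[symmetric]
    using 1 2 3 4 EGU ps l unfolding cs by auto
qed

text \<open>\<open>J\<close> commutes with \<open>B\<close> and conjugates the form, so
  \<open>JM U\<close> has the conjugated Jordan and Gram matrices, which are real. The last claim
  rewrites orthogonality to the columns and their \<open>J\<close> images as a linear
  equation.\<close>

lemma frame_basis:
  assumes F: "frame ps U"
  defines "S \<equiv> hcat U (JM U)" and "Om \<equiv> diag2 (Qs_mat ps) (Qs_mat ps)" and "r \<equiv> bsize ps + bsize ps"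
  shows "S \<in> carrier_mat d r" "B * S = S * diag2 (D_mat ps) (D_mat ps)"
    "mat_adjoint S * H * S = Om" "Om * Om = 1\<^sub>m r" "Om \<in> carrier_mat r r"
    "\<And>x. x \<in> V \<Longrightarrow> x \<in> perp U \<longleftrightarrow> mat_adjoint S *\<^sub>v (H *\<^sub>v x) = 0\<^sub>v r"
proof -
  have U: "U \<in> carrier_mat d (bsize ps)" and BU: "B * U = U * D_mat ps" and UU: "gram U U = Qs_mat ps"
    and iso: "\<And>x y. x \<in> cset U \<Longrightarrow> y \<in> cset U \<Longrightarrow> h (J x) y = 0"
    using F by (auto simp: frame_def)
  note JU = JM_carrier[OF U]
  show S: "S \<in> carrier_mat d r" unfolding S_def r_def using U JU by (rule hcat_carrier)
  have "B * JM U = JM U * D_mat ps"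
  proof -
    have BO: "B * quat_mat N = quat_mat N * map_mat cnj B"
      using B_sa by (simp add: quat_selfadjoint_def Omega_iff)
    have cU: "map_mat cnj U \<in> carrier_mat d (bsize ps)" using U by simp
    have cB: "map_mat cnj B \<in> carrier_mat d d" by simp
    have "B * JM U = quat_mat N * (map_mat cnj B * map_mat cnj U)"
      unfolding JM_def assoc_mult_mat[OF carriers(2) quat_mat_carrier cU, symmetric] BO
      by (rule assoc_mult_mat[OF quat_mat_carrier cB cU])
    also have "map_mat cnj B * map_mat cnj U = map_mat cnj U * map_mat cnj (D_mat ps)"
      unfolding cnj_hom.mat_hom_mult[OF carriers(2) U, symmetric] BU
      by (rule cnj_hom.mat_hom_mult[OF U D_mat_carrier])
    also have "quat_mat N * \<dots> = JM U * D_mat ps"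
      unfolding JM_def D_mat_real by (rule assoc_mult_mat[OF quat_mat_carrier cU D_mat_carrier, symmetric])
    finally show ?thesis .
  qed
  thus "B * S = S * diag2 (D_mat ps) (D_mat ps)"
    unfolding S_def mult_hcat[OF carriers(2) U JU] BU
    by (simp add: hcat_mult_diag2[OF U JU D_mat_carrier D_mat_carrier])
  have colc: "col U j \<in> cset U" "col U j \<in> V" if "j < bsize ps" for j
    using that U by (auto simp: cset_def)
  have "gram S S = diag2 (gram U U) (gram (JM U) (JM U))"
    unfolding S_def
  proof (rule gram_hcat[OF U JU])
    fix i j assume ij: "i < bsize ps" "j < bsize ps"
    have "h (col U i) (J (col U j)) = cnj (h (J (col U j)) (col U i))"
      using ij colc by (intro h_sym) auto
    thus "h (col U i) (col (JM U) j) = 0" using ij colc iso by (simp add: col_JM[OF U])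
  qed
  also have "gram (JM U) (JM U) = map_mat cnj (gram U U)"
  proof (rule eq_matI)
    fix i j assume "i < dim_row (map_mat cnj (gram U U))" "j < dim_col (map_mat cnj (gram U U))"
    hence ij: "i < bsize ps" "j < bsize ps" using U by auto
    thus "gram (JM U) (JM U) $$ (i, j) = map_mat cnj (gram U U) $$ (i, j)"
      using U carrier_matD[OF JU] colc(2) by (simp add: gram_def col_JM[OF U] h_J)
  qed (use U carrier_matD[OF JU] in auto)
  finally have "gram S S = Om" unfolding UU Qs_mat_real Om_def .
  thus "mat_adjoint S * H * S = Om" using gram_eq[OF S S] by simp
  show "Om * Om = 1\<^sub>m r" unfolding Om_def r_def
    by (subst diag2_mult[of _ "bsize ps" _ _ "bsize ps"]) (auto simp: Qs_mat_square diag2_one)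
  show "Om \<in> carrier_mat r r" by (simp add: Om_def r_def)
  fix x assume x: "x \<in> V"
  have "mat_adjoint S *\<^sub>v (H *\<^sub>v x) = 0\<^sub>v r \<longleftrightarrow> (\<forall>i<r. (mat_adjoint S *\<^sub>v (H *\<^sub>v x)) $ i = 0)"
    using S by (auto simp: vec_eq_iff simp del: index_mult_mat_vec)
  also have "\<dots> \<longleftrightarrow> (\<forall>i<r. h (col S i) x = 0)"
    using x by (simp add: mat_adjoint_mv[OF S] h_def)
  also have "\<dots> \<longleftrightarrow> (\<forall>c \<in> cset S. h c x = 0)" using S by (auto simp: cset_def)
  also have "cset S = cset U \<union> cset (JM U)" unfolding S_def by (rule cset_hcat[OF U JU])
  also have "cset (JM U) = J ` cset U"
    unfolding cset_def image_image using U carrier_matD[OF JU] by (intro image_cong) (auto simp: col_JM[OF U])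
  finally show "x \<in> perp U \<longleftrightarrow> mat_adjoint S *\<^sub>v (H *\<^sub>v x) = 0\<^sub>v r"
    using x by (auto simp: perp_def)
qed

text \<open>As \<open>Om\<close> is the Gram matrix of \<open>S\<close> and its own inverse,
  \<open>S * Om * mat_adjoint S * H\<close> is the orthogonal projection to the span of the columns
  of \<open>S\<close>; the remainder lies in the complement.\<close>

lemma frame_split:
  assumes F: "frame ps U" and y: "y \<in> V"
  defines "S \<equiv> hcat U (JM U)" and "Om \<equiv> diag2 (Qs_mat ps) (Qs_mat ps)"
  shows "y - S *\<^sub>v (Om *\<^sub>v (mat_adjoint S *\<^sub>v (H *\<^sub>v y))) \<in> perp U"
proof -
  note fs = frame_basis[OF F, folded S_def Om_def]
  let ?r = "bsize ps + bsize ps"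
  define z where "z = mat_adjoint S *\<^sub>v (H *\<^sub>v y)"
  have A: "mat_adjoint S \<in> carrier_mat ?r d" using fs(1) by simp
  have z: "z \<in> carrier_vec ?r" unfolding z_def using A y by (intro mult_mat_vec_carrier) auto
  have Oz: "Om *\<^sub>v z \<in> carrier_vec ?r" using fs(5) z by (rule mult_mat_vec_carrier)
  have Sz: "S *\<^sub>v (Om *\<^sub>v z) \<in> V" using fs(1) Oz by (rule mult_mat_vec_carrier)
  have yz: "y - S *\<^sub>v (Om *\<^sub>v z) \<in> V" using y Sz by (rule minus_carrier_vec)
  have AH: "mat_adjoint S * H \<in> carrier_mat ?r d" using A carriers(1) by (rule mult_carrier_mat)
  have "mat_adjoint S *\<^sub>v (H *\<^sub>v (S *\<^sub>v (Om *\<^sub>v z))) = z"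
  proof -
    have "mat_adjoint S *\<^sub>v (H *\<^sub>v (S *\<^sub>v (Om *\<^sub>v z))) = (mat_adjoint S * H) *\<^sub>v (S *\<^sub>v (Om *\<^sub>v z))"
      by (rule assoc_mult_mat_vec[OF A carriers(1) Sz, symmetric])
    also have "\<dots> = Om *\<^sub>v (Om *\<^sub>v z)"
      unfolding assoc_mult_mat_vec[OF AH fs(1) Oz, symmetric] fs(3) ..
    also have "\<dots> = z" unfolding assoc_mult_mat_vec[OF fs(5,5) z, symmetric] fs(4) using z by simp
    finally show ?thesis .
  qed
  moreover have "mat_adjoint S *\<^sub>v (H *\<^sub>v (y - S *\<^sub>v (Om *\<^sub>v z))) =
      z - mat_adjoint S *\<^sub>v (H *\<^sub>v (S *\<^sub>v (Om *\<^sub>v z)))"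
  proof -
    have "H *\<^sub>v y \<in> V" "H *\<^sub>v (S *\<^sub>v (Om *\<^sub>v z)) \<in> V" using y Sz by auto
    from mult_minus_distrib_mat_vec[OF A this] show ?thesis
      by (simp only: mult_minus_distrib_mat_vec[OF carriers(1) y Sz] z_def[symmetric])
  qed
  ultimately have "mat_adjoint S *\<^sub>v (H *\<^sub>v (y - S *\<^sub>v (Om *\<^sub>v z))) = 0\<^sub>v ?r"
    using z by simp
  thus ?thesis using fs(6)[OF yz] unfolding z_def by simp
qed

text \<open>Every vector is a sum of a vector of \<open>perp U\<close> and a combination of the
  columns of \<open>S\<close>. Both summands are orthogonal to \<open>x\<close>, so the assertion
  reduces to nondegeneracy of the full form.\<close>

lemma frame_nondegenerate:
  assumes F: "frame ps U"
  shows "nondegenerate (perp U)"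
  unfolding nondegenerate_def
proof (intro ballI impI)
  fix x assume x: "x \<in> perp U" and hx: "\<forall>y\<in>perp U. h x y = 0"
  define S where "S = hcat U (JM U)"
  define Om where "Om = diag2 (Qs_mat ps) (Qs_mat ps)"
  let ?r = "bsize ps + bsize ps"
  note fs = frame_basis[OF F, folded S_def Om_def]
  have xV: "x \<in> V" using x by (simp add: perp_def)
  have A: "mat_adjoint S \<in> carrier_mat ?r d" using fs(1) by simp
  have "h y x = 0" if y: "y \<in> V" for y
  proof -
    define a where "a = Om *\<^sub>v (mat_adjoint S *\<^sub>v (H *\<^sub>v y))"
    have a: "a \<in> carrier_vec ?r" unfolding a_def
      by (rule mult_mat_vec_carrier[OF fs(5) mult_mat_vec_carrier[OF A]]) (use y in simp)
    have Sa: "S *\<^sub>v a \<in> V" using fs(1) a by (rule mult_mat_vec_carrier)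
    have p: "y - S *\<^sub>v a \<in> perp U" using frame_split[OF F y] by (simp add: a_def S_def Om_def)
    have pV: "y - S *\<^sub>v a \<in> V" using p by (simp add: perp_def)
    have "h (S *\<^sub>v a) x = (mat_adjoint S *\<^sub>v (H *\<^sub>v x)) \<bullet>c a"
      unfolding h_def by (rule cscalar_prod_mat_adjoint[OF fs(1) a]) (use xV in simp)
    also have "mat_adjoint S *\<^sub>v (H *\<^sub>v x) = 0\<^sub>v ?r" using fs(6)[OF xV] x by simp
    finally have 1: "h (S *\<^sub>v a) x = 0" using a by simp
    have "h (y - S *\<^sub>v a) x = cnj (h x (y - S *\<^sub>v a))" using xV pV by (intro h_sym)
    also have "\<dots> = 0" using hx p by simp
    finally have 2: "h (y - S *\<^sub>v a) x = 0" .
    have "y = (y - S *\<^sub>v a) + S *\<^sub>v a" using y carrier_matD(1)[OF fs(1)] by (intro eq_vecI) (auto simp del: index_mult_mat_vec)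
    hence "h y x = h (y - S *\<^sub>v a) x + h (S *\<^sub>v a) x" using h_add_left[OF xV pV Sa] by metis
    thus ?thesis using 1 2 by simp
  qed
  \<comment> \<open>Testing against \<open>H *\<^sub>v x\<close> turns orthogonality for the
    indefinite form into a vanishing positive definite norm.\<close>
  from this[of "H *\<^sub>v x"] have "(H *\<^sub>v x) \<bullet>c (H *\<^sub>v x) = 0" using xV by (simp add: h_def)
  hence "H *\<^sub>v x = 0\<^sub>v d" using conjugate_square_eq_0_vec[of "H *\<^sub>v x" d] xV by simp
  thus "x = 0\<^sub>v d" using H_inj[OF xV] by simp
qed

lemma frame_left_inverse:
  assumes F: "frame ps U"
  defines "S \<equiv> hcat U (JM U)" and "Om \<equiv> diag2 (Qs_mat ps) (Qs_mat ps)" and "r \<equiv> bsize ps + bsize ps"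
  shows "Om * (mat_adjoint S * H) * S = 1\<^sub>m r" "Om * (mat_adjoint S * H) \<in> carrier_mat r d"
proof -
  note fs = frame_basis[OF F, folded S_def Om_def r_def]
  have AH: "mat_adjoint S * H \<in> carrier_mat r d" using fs(1) carriers(1) by (intro mult_carrier_mat) auto
  show "Om * (mat_adjoint S * H) * S = 1\<^sub>m r"
    unfolding assoc_mult_mat[OF fs(5) AH fs(1)] fs(3) fs(4) ..
  show "Om * (mat_adjoint S * H) \<in> carrier_mat r d" using fs(5) AH by (rule mult_carrier_mat)
qed

lemma canonical_form:
  "\<exists>S \<in> Omega N. \<exists>T \<in> carrier_mat d d. \<exists>ps. (\<forall>(k, l) \<in> set ps. k \<ge> 1 \<and> l < 0) \<and>
     S * T = 1\<^sub>m d \<and> T * S = 1\<^sub>m d \<and> B * S = S * diag2 (D_mat ps) (D_mat ps) \<and>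
     mat_adjoint S * H * S = diag2 (Qs_mat ps) (Qs_mat ps)"
proof -
  define P where "P r \<longleftrightarrow> (\<exists>ps U. frame ps U \<and> bsize ps = r)" for r
  \<comment> \<open>A left inverse bounds the number of columns of a frame, so a frame of maximal
    size exists.\<close>
  have bound: "r \<le> d" if Pr: "P r" for r
  proof -
    obtain ps U where f: "frame ps U" "bsize ps = r" using Pr unfolding P_def by blast
    have "bsize ps + bsize ps \<le> d"
      by (rule left_inverse_dim_le[OF frame_basis(1)[OF f(1)] frame_left_inverse(2,1)[OF f(1)]])
    thus ?thesis using f by simp
  qed
  have "P 0" unfolding P_def using frame_Nil by (metis bsize_simps(1))
  then obtain r where r: "P r" and max: "\<And>r'. P r' \<Longrightarrow> r' \<le> r"
    using Nat.ex_has_greatest_nat[of P 0 d] bound by blast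
  obtain ps U where F: "frame ps U" and r_def: "bsize ps = r" using r unfolding P_def by blast
  have U: "U \<in> carrier_mat d (bsize ps)" and inv: "invariant (perp U)" using F by (auto simp: frame_def)
  have perp0: "x = 0\<^sub>v d" if xp: "x \<in> perp U" for x
  proof (rule ccontr)
    assume "x \<noteq> 0\<^sub>v d"
    then obtain l k u v where "l < 0" "u \<in> perp U" "v \<in> perp U" "chain_pair l k u v"
      using chain_pair_exists[OF inv frame_nondegenerate[OF F] xp] by blast
    \<comment> \<open>The pair contributes \<open>Suc k + Suc k\<close> columns, so even
      \<open>k = 0\<close> enlarges the frame.\<close>
    from frame_extend[OF F this] have "P (bsize ((Suc k, l) # ps))" unfolding P_def by blast
    from max[OF this] show False using r_def by simp
  qed
  define S where "S = hcat U (JM U)"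
  define Om where "Om = diag2 (Qs_mat ps) (Qs_mat ps)"
  define X where "X = Om * (mat_adjoint S * H)"
  note fs = frame_basis[OF F, folded S_def Om_def]
  let ?r = "bsize ps + bsize ps"
  have X: "X \<in> carrier_mat ?r d" and XS: "X * S = 1\<^sub>m ?r"
    unfolding X_def S_def Om_def using frame_left_inverse[OF F] by auto
  have A: "mat_adjoint S \<in> carrier_mat ?r d" using fs(1) by simp
  \<comment> \<open>The remainder in \<open>frame_split\<close> is zero because
    \<open>perp U\<close> is trivial, which makes the left inverse also a right inverse.\<close>
  have SXv: "(S * X) *\<^sub>v y = y" if y: "y \<in> V" for y
  proof -
    have "y - S *\<^sub>v (Om *\<^sub>v (mat_adjoint S *\<^sub>v (H *\<^sub>v y))) = 0\<^sub>v d"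
      using perp0 frame_split[OF F y] by (simp add: S_def Om_def)
    moreover have "Om *\<^sub>v (mat_adjoint S *\<^sub>v (H *\<^sub>v y)) = X *\<^sub>v y"
      unfolding X_def assoc_mult_mat_vec[OF A carriers(1) y, symmetric]
      by (rule assoc_mult_mat_vec[OF fs(5) mult_carrier_mat[OF A carriers(1)] y, symmetric])
    moreover have "S *\<^sub>v (X *\<^sub>v y) = (S * X) *\<^sub>v y" by (rule assoc_mult_mat_vec[OF fs(1) X y, symmetric])
    ultimately have z: "y - (S * X) *\<^sub>v y = 0\<^sub>v d" by simp
    define w where "w = (S * X) *\<^sub>v y"
    have "w \<in> V" unfolding w_def using mult_carrier_mat[OF fs(1) X] y by (rule mult_mat_vec_carrier)
    moreover have "y - w = 0\<^sub>v d" using z by (simp add: w_def)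
    ultimately have "w $ i = y $ i" if "i < d" for i
      using that y by (metis carrier_vecD eq_iff_diff_eq_0 index_minus_vec(1) index_zero_vec(1))
    hence "w = y" using \<open>w \<in> V\<close> y by (intro eq_vecI) auto
    thus ?thesis by (simp only: w_def)
  qed
  have SX: "S * X = 1\<^sub>m d"
  proof (rule mat_col_eqI)
    fix j assume "j < dim_col (1\<^sub>m d :: complex mat)"
    hence j: "j < d" by simp
    have c: "S * X \<in> carrier_mat d d" using fs(1) X by (rule mult_carrier_mat)
    have "col (S * X) j = col (S * X * 1\<^sub>m d) j" by (simp only: right_mult_one_mat[OF c])
    also have "\<dots> = (S * X) *\<^sub>v col (1\<^sub>m d) j" by (rule col_mult2[OF c one_carrier_mat j])
    also have "\<dots> = col (1\<^sub>m d) j" by (rule SXv) (use j in simp)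
    finally show "col (S * X) j = col (1\<^sub>m d) j" .
  qed (use fs(1) X in auto)
  \<comment> \<open>Only at this point is \<open>S\<close> known to be square, and \<open>U\<close>
    to have exactly \<open>N\<close> columns as the block shape of \<open>Omega\<close>
    demands.\<close>
  have "?r \<le> d" by (rule left_inverse_dim_le[OF fs(1) X XS])
  moreover have "d \<le> ?r" by (rule left_inverse_dim_le[OF X fs(1) SX])
  ultimately have rN: "bsize ps = N" by simp
  have "S \<in> Omega N"
  proof -
    have U': "U \<in> carrier_mat d N" using U rN by simp
    define A1 where "A1 = mat N N (\<lambda>(i, j). U $$ (i, j))"
    define A2 where "A2 = mat N N (\<lambda>(i, j). - U $$ (i + N, j))"
    have JMi: "JM U $$ (i, j) = (if i < N then - cnj (U $$ (i + N, j)) else cnj (U $$ (i - N, j)))"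
      if ij: "i < d" "j < N" for i j
    proof -
      \<comment> \<open>Right blocks of width zero turn a column of two blocks into a four-block
        matrix, so that the product rule for blocks applies.\<close>
      have 1: "map_mat cnj U = four_block_mat (map_mat cnj A1) (0\<^sub>m N 0) (- map_mat cnj A2) (0\<^sub>m N 0)"
        using U' by (intro eq_matI) (auto simp: A1_def A2_def)
      have "JM U = four_block_mat (map_mat cnj A2) (0\<^sub>m N 0) (map_mat cnj A1) (0\<^sub>m N 0)"
        unfolding JM_def quat_mat_def 1
        by (subst mult_four_block_mat[of _ N N _ N _ N _ _ N _ 0]) (auto simp: A1_def A2_def intro!: cong_four_block_mat eq_matI)
      thus ?thesis using ij by (simp add: A1_def A2_def)
    qed
    have "S = four_block_mat A1 (map_mat cnj A2) (- A2) (map_mat cnj A1)"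
    proof (rule eq_matI)
      fix i j assume "i < dim_row (four_block_mat A1 (map_mat cnj A2) (- A2) (map_mat cnj A1))"
        "j < dim_col (four_block_mat A1 (map_mat cnj A2) (- A2) (map_mat cnj A1))"
      hence ij: "i < d" "j < d" by (auto simp: A1_def A2_def)
      show "S $$ (i, j) = four_block_mat A1 (map_mat cnj A2) (- A2) (map_mat cnj A1) $$ (i, j)"
        using ij U' carrier_matD[OF JM_carrier[OF U']] JMi[of i "j - N"]
        by (auto simp: S_def hcat_def A1_def A2_def)
    qed (use fs(1) rN in \<open>auto simp: A1_def A2_def\<close>)
    moreover have "A1 \<in> carrier_mat N N" "A2 \<in> carrier_mat N N" by (auto simp: A1_def A2_def)
    ultimately show ?thesis unfolding Omega_def by blast
  qed
  thus ?thesis using X XS SX fs(2,3) F unfolding rN frame_def Om_def by blast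
qed

end

section \<open>The complex structure of a canonical form\<close>

text \<open>\<open>quat_mat k\<close> is reused as a real linear rotation by a right angle,
  independently of the antilinear structure \<open>J\<close>.\<close>

fun rot_mat :: "(nat \<times> real) list \<Rightarrow> complex mat" where
  "rot_mat [] = 0\<^sub>m 0 0"
| "rot_mat ((k, l) # ps) = diag2 (quat_mat k) (rot_mat ps)"

lemma rot_mat_carrier [simp]: "rot_mat ps \<in> carrier_mat (bsize ps) (bsize ps)"
proof (induction ps)
  case (Cons p ps)
  obtain k l where p: "p = (k, l)" by (cases p)
  show ?case using diag2_carrier[OF quat_mat_carrier[of k] Cons] by (simp add: p add.assoc)
qed simp

text \<open>The rotation commutes with two equal Jordan blocks. Its adjoint is its negative, but it
  also exchanges the blocks \<open>Q_mat k\<close> and \<open>- Q_mat k\<close>; the two signs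
  compensate, and the rotation is selfadjoint for their sum.\<close>

lemma rot_mat_props:
  "rot_mat ps * rot_mat ps = - 1\<^sub>m (bsize ps)"
  "rot_mat ps * D_mat ps = D_mat ps * rot_mat ps"
  "Qs_mat ps * rot_mat ps = mat_adjoint (rot_mat ps) * Qs_mat ps"
  "map_mat cnj (rot_mat ps) = rot_mat ps"
proof (induction ps)
  case Nil
  {
    case 1 show ?case by auto
  next
    case 2 show ?case by (auto simp: D_mat_simps)
  next
    case 3 show ?case by (auto simp: Qs_mat_simps)
  next
    case 4 show ?case by auto
  }
next
  case (Cons p ps)
  obtain k l where p: "p = (k, l)" by (cases p)
  let ?J = "jordan_block k (complex_of_real l)" and ?P = "quat_mat k" and ?R = "rot_mat ps"
  have J: "?J \<in> carrier_mat k k" by simp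
  have JJ: "diag2 ?J ?J \<in> carrier_mat (k + k) (k + k)" using J J by (rule diag2_carrier)
  have QQ: "diag2 (Q_mat k) (- Q_mat k) \<in> carrier_mat (k + k) (k + k)" by (rule diag2_carrier) auto
  have Pa: "- ?P \<in> carrier_mat (k + k) (k + k)" by simp
  have Ra: "mat_adjoint ?R \<in> carrier_mat (bsize ps) (bsize ps)" by simp
  note Dc = D_mat_carrier[of ps] and Qc = Qs_mat_carrier[of ps] and Rc = rot_mat_carrier[of ps]
    and Pc = quat_mat_carrier[of k]
  have D: "D_mat (p # ps) = diag2 (diag2 ?J ?J) (D_mat ps)" by (simp add: p D_mat_simps diag2_assoc)
  have Q: "Qs_mat (p # ps) = diag2 (diag2 (Q_mat k) (- Q_mat k)) (Qs_mat ps)" by (simp add: p Qs_mat_simps diag2_assoc)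
  have R: "rot_mat (p # ps) = diag2 ?P ?R" by (simp add: p)
  {
    case 1
    have "- 1\<^sub>m (k + k + bsize ps) = diag2 (- 1\<^sub>m (k + k)) (- 1\<^sub>m (bsize ps))"
      by (rule eq_matI) (auto simp: diag2_def)
    thus ?case unfolding R diag2_mult[OF Pc Pc Rc Rc] quat_mat_square Cons.IH(1) by (simp add: p add.assoc)
  next
    case 2
    have "?P * diag2 ?J ?J = diag2 ?J ?J * ?P"
      unfolding quat_mat_def diag2_def
      by (subst (1 2) mult_four_block_mat[of _ k k _ k _ k _ _ k _ k]) auto
    thus ?case unfolding R D diag2_mult[OF Pc JJ Rc Dc] diag2_mult[OF JJ Pc Dc Rc] Cons.IH(2) by simp
  next
    case 3
    have "diag2 (Q_mat k) (- Q_mat k) * ?P = - ?P * diag2 (Q_mat k) (- Q_mat k)"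
    proof -
      have "diag2 (Q_mat k) (- Q_mat k) * ?P = four_block_mat (0\<^sub>m k k) (- Q_mat k) (- Q_mat k) (0\<^sub>m k k)"
        unfolding quat_mat_def diag2_def
        by (subst mult_four_block_mat[of _ k k _ k _ k _ _ k _ k]) auto
      moreover have "?P * diag2 (Q_mat k) (- Q_mat k) = four_block_mat (0\<^sub>m k k) (Q_mat k) (Q_mat k) (0\<^sub>m k k)"
        unfolding quat_mat_def diag2_def
        by (subst mult_four_block_mat[of _ k k _ k _ k _ _ k _ k]) auto
      moreover have "- four_block_mat (0\<^sub>m k k) (Q_mat k) (Q_mat k) (0\<^sub>m k k) =
          four_block_mat (0\<^sub>m k k) (- Q_mat k) (- Q_mat k) (0\<^sub>m k k)"
        by (rule eq_matI) auto
      moreover have "- ?P * diag2 (Q_mat k) (- Q_mat k) = - (?P * diag2 (Q_mat k) (- Q_mat k))"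
        by (rule uminus_mult_left_mat) (use carrier_matD[OF QQ] in simp)
      ultimately show ?thesis by simp
    qed
    thus ?case unfolding R Q diag2_adjoint diag2_mult[OF QQ Pc Qc Rc] diag2_mult[OF Pa QQ Ra Qc]
      Cons.IH(3) quat_mat_adjoint by simp
  next
    case 4
    have "map_mat cnj (diag2 ?P ?R) = diag2 (map_mat cnj ?P) (map_mat cnj ?R)"
      unfolding diag2_def by (rule eq_matI) auto
    thus ?case unfolding R using Cons.IH(4) by (simp add: quat_mat_cnj)
  }
qed

text \<open>The block shape with \<open>A2\<close> equal to zero.\<close>

lemma real_diag2_Omega:
  assumes "A \<in> carrier_mat N N" "map_mat cnj A = A"
  shows "diag2 A A \<in> Omega N"
proof -
  have "diag2 A A = four_block_mat A (map_mat cnj (0\<^sub>m N N)) (- 0\<^sub>m N N) (map_mat cnj A)"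
    using assms unfolding diag2_def by (intro cong_four_block_mat) (auto intro!: eq_matI)
  thus ?thesis unfolding Omega_def using assms(1) zero_carrier_mat[of N N] by blast
qed

lemma similar_mult:
  assumes c: "S \<in> carrier_mat d d" "T \<in> carrier_mat d d" "X \<in> carrier_mat d d" "Y \<in> carrier_mat d d"
    and TS: "T * S = 1\<^sub>m d"
  shows "(S * X * T) * (S * Y * T) = S * (X * Y) * (T :: complex mat)"
proof -
  note m = mult_carrier_mat
  have "(S * X * T) * (S * Y * T) = S * X * (T * (S * (Y * T)))"
    by (simp only: assoc_mult_mat[OF c(1,4,2)] assoc_mult_mat[OF m[OF c(1,3)] c(2) m[OF c(1) m[OF c(4,2)]]])
  also have "T * (S * (Y * T)) = Y * T"
    by (simp only: assoc_mult_mat[OF c(2,1) m[OF c(4,2)], symmetric] TS left_mult_one_mat[OF m[OF c(4,2)]])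
  also have "S * X * (Y * T) = S * (X * Y) * T"
    by (simp only: assoc_mult_mat[OF c(1,3) m[OF c(4,2)]] assoc_mult_mat[OF c(3,4,2)]
        assoc_mult_mat[OF c(1) m[OF c(3,4)] c(2)])
  finally show ?thesis .
qed

lemma complex_structure_of_canonical_form:
  assumes S: "S \<in> Omega N" and T: "T \<in> carrier_mat (N + N) (N + N)"
    and ST: "S * T = 1\<^sub>m (N + N)" "T * S = 1\<^sub>m (N + N)"
    and B: "B \<in> carrier_mat (N + N) (N + N)" and H: "H \<in> carrier_mat (N + N) (N + N)"
    and BS: "T * B * S = diag2 (D_mat ps) (D_mat ps)"
    and HS: "mat_adjoint S * H * S = diag2 (Qs_mat ps) (Qs_mat ps)"
  shows "\<exists>K. quat_selfadjoint N H K \<and> K * B = B * K \<and> K * K = - 1\<^sub>m (N + N)"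
proof -
  let ?d = "N + N"
  note m = mult_carrier_mat
  note Sc = Omega_carrier[OF S]
  \<comment> \<open>The length of the canonical form is not given; it is read off from the
    dimensions in \<open>BS\<close>.\<close>
  have "bsize ps + bsize ps = N + N"
    using arg_cong[OF BS, of dim_row] T carrier_matD[OF D_mat_carrier[of ps]] by (simp add: diag2_def)
  hence ps: "bsize ps = N" by simp
  define R where "R = diag2 (rot_mat ps) (rot_mat ps)"
  define D where "D = diag2 (D_mat ps) (D_mat ps)"
  define Q where "Q = diag2 (Qs_mat ps) (Qs_mat ps)"
  note r = rot_mat_carrier[of ps, unfolded ps] and dm = D_mat_carrier[of ps, unfolded ps]
    and q = Qs_mat_carrier[of ps, unfolded ps]
  have c: "R \<in> carrier_mat ?d ?d" "D \<in> carrier_mat ?d ?d" "Q \<in> carrier_mat ?d ?d"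
    unfolding R_def D_def Q_def using r dm q by (auto intro: diag2_carrier)
  have RR: "R * R = - 1\<^sub>m ?d"
  proof -
    have "R * R = diag2 (- 1\<^sub>m N) (- 1\<^sub>m N)"
      unfolding R_def diag2_mult[OF r r r r] rot_mat_props(1) ps ..
    also have "\<dots> = - 1\<^sub>m ?d" by (rule eq_matI) (auto simp: diag2_def)
    finally show ?thesis .
  qed
  have RD: "R * D = D * R"
    unfolding R_def D_def diag2_mult[OF r dm r dm] diag2_mult[OF dm r dm r] rot_mat_props(2) ..
  have QR: "Q * R = mat_adjoint R * Q"
    unfolding R_def Q_def diag2_adjoint diag2_mult[OF q r q r] rot_mat_props(3)
    by (rule diag2_mult[symmetric]) (use r q in auto)
  have R_Omega: "R \<in> Omega N" unfolding R_def by (rule real_diag2_Omega[OF r rot_mat_props(4)])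
  have BD: "B = S * D * T"
  proof -
    have "S * D * T = S * (T * B * S) * T" by (simp only: BS D_def)
    also have "\<dots> = (S * T) * B * (S * T)"
      using Sc T B by (simp add: assoc_mult_mat[of _ ?d ?d _ ?d _ ?d] m[of _ ?d ?d])
    finally show ?thesis unfolding ST using B by simp
  qed
  note Sa = mat_adjoint_carrier[OF Sc] and Ta = mat_adjoint_carrier[OF T] and Ra = mat_adjoint_carrier[OF c(1)]
  have TSa: "mat_adjoint T * mat_adjoint S = 1\<^sub>m ?d"
  proof -
    have "mat_adjoint T * mat_adjoint S = mat_adjoint (1\<^sub>m ?d)" unfolding ST(1)[symmetric]
      by (rule mat_adjoint_mult[OF Sc T, symmetric])
    also have "\<dots> = 1\<^sub>m ?d" by (rule eq_matI) auto
    finally show ?thesis .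
  qed
  have STa: "mat_adjoint S * mat_adjoint T = 1\<^sub>m ?d"
    by (rule mat_mult_left_right_inverse[OF Ta Sa TSa])
  have HQ: "H = mat_adjoint T * Q * T"
  proof -
    have "mat_adjoint T * Q * T = mat_adjoint T * (mat_adjoint S * H * S) * T" by (simp only: HS Q_def)
    also have "\<dots> = (mat_adjoint T * mat_adjoint S) * H * (S * T)"
      using Sc T H Sa Ta by (simp add: assoc_mult_mat[of _ ?d ?d _ ?d _ ?d] m[of _ ?d ?d])
    finally show ?thesis unfolding ST TSa using H by simp
  qed
  \<comment> \<open>The rotation is transported back by \<open>S\<close>. Its relations to
    \<open>D\<close> and \<open>Q\<close> become those to \<open>B\<close> and \<open>H\<close>, and
    it stays in \<open>Omega\<close> because the inverse \<open>T\<close> lies there too.\<close>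
  define K where "K = S * R * T"
  have K_Omega: "K \<in> Omega N" unfolding K_def
    by (intro Omega_mult S R_Omega Omega_inverse[OF S T ST])
  have "K * K = - 1\<^sub>m ?d"
  proof -
    have "K * K = S * (- 1\<^sub>m ?d) * T" unfolding K_def similar_mult[OF Sc T c(1,1) ST(2)] RR ..
    also have "\<dots> = - (S * T)" using Sc T by simp
    finally show ?thesis unfolding ST .
  qed
  moreover have "K * B = B * K"
    unfolding K_def BD similar_mult[OF Sc T c(1,2) ST(2)] similar_mult[OF Sc T c(2,1) ST(2)] RD ..
  moreover have "H * K = mat_adjoint K * H"
  proof -
    have Ka: "mat_adjoint K = mat_adjoint T * mat_adjoint R * mat_adjoint S"
      unfolding K_def mat_adjoint_mult[OF m[OF Sc c(1)] T] mat_adjoint_mult[OF Sc c(1)]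
      by (rule assoc_mult_mat[OF Ta Ra Sa, symmetric])
    have "H * K = mat_adjoint T * (Q * R) * T"
    proof -
      have "H * K = mat_adjoint T * Q * (T * S) * R * T"
        unfolding HQ K_def using Sc T c Ta by (simp add: assoc_mult_mat[of _ ?d ?d _ ?d _ ?d] m[of _ ?d ?d])
      also have "\<dots> = mat_adjoint T * (Q * R) * T"
        unfolding ST using T c Ta by (simp add: assoc_mult_mat[of _ ?d ?d _ ?d _ ?d] m[of _ ?d ?d])
      finally show ?thesis .
    qed
    moreover have "mat_adjoint K * H = mat_adjoint T * (mat_adjoint R * Q) * T"
    proof -
      have "mat_adjoint K * H = mat_adjoint T * mat_adjoint R * (mat_adjoint S * mat_adjoint T) * Q * T"
        unfolding HQ Ka using Sa Ra T c Ta by (simp add: assoc_mult_mat[of _ ?d ?d _ ?d _ ?d] m[of _ ?d ?d])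
      also have "\<dots> = mat_adjoint T * (mat_adjoint R * Q) * T"
        unfolding STa using T c Ta Ra by (simp add: assoc_mult_mat[of _ ?d ?d _ ?d _ ?d] m[of _ ?d ?d])
      finally show ?thesis .
    qed
    ultimately show ?thesis unfolding QR by simp
  qed
  ultimately show ?thesis using K_Omega unfolding quat_selfadjoint_def H_selfadjoint_def by blast
qed

text \<open>\<open>inv_mat\<close> is a definite description, so uniqueness of the inverse has to be
  shown; the shape of a candidate follows from the sizes of the identity matrices in the two
  equations.\<close>

lemma invertible_mat_inverse:
  fixes S :: "complex mat"
  assumes S: "S \<in> carrier_mat d d" and inv: "invertible_mat S"
  shows "inv_mat S \<in> carrier_mat d d" "S * inv_mat S = 1\<^sub>m d" "inv_mat S * S = 1\<^sub>m d"
proof -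
  obtain T where T: "inverts_mat S T" "inverts_mat T S" using inv by (auto simp: invertible_mat_def)
  have *: "T' \<in> carrier_mat d d \<and> S * T' = 1\<^sub>m d \<and> T' * S = 1\<^sub>m d" if "inverts_mat S T'" "inverts_mat T' S" for T'
  proof -
    have 1: "S * T' = 1\<^sub>m d" "T' * S = 1\<^sub>m (dim_row T')" using that S by (auto simp: inverts_mat_def)
    have "dim_col T' = d" using arg_cong[OF 1(1), of dim_col] by simp
    moreover have "dim_row T' = d" using arg_cong[OF 1(2), of dim_col] S by simp
    ultimately show ?thesis using 1 by auto
  qed
  have "inv_mat S = T" unfolding inv_mat_def
  proof (rule the_equality)
    fix T' assume "inverts_mat S T' \<and> inverts_mat T' S"
    hence T': "T' \<in> carrier_mat d d" "T' * S = 1\<^sub>m d" using * by auto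
    have "T' = T' * (S * T)" using *[OF T] T' by simp
    also have "\<dots> = T' * S * T" by (rule assoc_mult_mat[symmetric]) (use *[OF T] T' S in auto)
    also have "\<dots> = T" unfolding T'(2) using *[OF T] by (intro left_mult_one_mat) auto
    finally show "T' = T" .
  qed (use T in simp)
  thus "inv_mat S \<in> carrier_mat d d" "S * inv_mat S = 1\<^sub>m d" "inv_mat S * S = 1\<^sub>m d"
    using *[OF T] by auto
qed

theorem mainTheorem8:
  fixes m n :: nat and Ht Bt :: "complex mat"
  assumes "even m" and "m > 0"
    and "Ht \<in> Omega (2 * n)" and "invertible_mat Ht" and "hermitian_mat Ht"
    and "Bt \<in> Omega (2 * n)" and "H_selfadjoint Ht Bt"
    and "spectrum_mat Bt \<subseteq> complex_of_real ` {x. x < 0}"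
  shows "(\<exists>At \<in> Omega (2 * n). H_selfadjoint Ht At \<and> At ^\<^sub>m m = Bt) \<longleftrightarrow>
         (\<exists>S \<in> Omega (2 * n). \<exists>ps :: (nat \<times> real) list.
            invertible_mat S \<and> (\<forall>(k, l) \<in> set ps. k \<ge> 1 \<and> l < 0) \<and>
            inv_mat S * Bt * S = diag_block_mat (jordan_part ps @ jordan_part ps) \<and>
            mat_adjoint S * Ht * S = diag_block_mat (Q_part ps @ Q_part ps))"
proof -
  define N where "N = 2 * n"
  note A = assms[folded N_def]
  note H = Omega_carrier[OF A(3)] and B = Omega_carrier[OF A(6)]
  have B_sa: "quat_selfadjoint N Ht Bt" using A by (simp add: quat_selfadjoint_def)
  have dg: "diag_block_mat (jordan_part ps @ jordan_part ps) = diag2 (D_mat ps) (D_mat ps)"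
    "diag_block_mat (Q_part ps @ Q_part ps) = diag2 (Qs_mat ps) (Qs_mat ps)" for ps
    by (simp_all add: diag_block_mat_append2 D_mat_def Qs_mat_def)
  have "(\<exists>At \<in> Omega N. H_selfadjoint Ht At \<and> At ^\<^sub>m m = Bt) \<longleftrightarrow>
    (\<exists>K. quat_selfadjoint N Ht K \<and> K * Bt = Bt * K \<and> K * K = - 1\<^sub>m (N + N))" (is "?root \<longleftrightarrow> ?structure")
    using complex_structure_of_root[OF H _ _ A(1,2,8)] root_of_complex_structure[OF H B_sa A(8) _ _ _ A(2)]
    unfolding quat_selfadjoint_def by blast
  also have "\<dots> \<longleftrightarrow> (\<exists>S \<in> Omega N. \<exists>ps :: (nat \<times> real) list.
            invertible_mat S \<and> (\<forall>(k, l) \<in> set ps. k \<ge> 1 \<and> l < 0) \<and>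
            inv_mat S * Bt * S = diag_block_mat (jordan_part ps @ jordan_part ps) \<and>
            mat_adjoint S * Ht * S = diag_block_mat (Q_part ps @ Q_part ps))" (is "_ \<longleftrightarrow> ?canonical")
  proof
    assume ?structure
    then obtain K where K: "quat_selfadjoint N Ht K" "K * Bt = Bt * K" "K * K = - 1\<^sub>m (N + N)" by blast
    note I = invertible_mat_inverse[OF H A(4)]
    interpret quat_complex_structure N Ht Bt K
    proof unfold_locales
      show "mat_adjoint Ht = Ht" using A(5) by (simp add: hermitian_mat_def)
      fix x assume x: "x \<in> carrier_vec (N + N)" "Ht *\<^sub>v x = 0\<^sub>v (N + N)"
      have "x = (inv_mat Ht * Ht) *\<^sub>v x" unfolding I(3) using x by simp
      also have "\<dots> = inv_mat Ht *\<^sub>v 0\<^sub>v (N + N)"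
        unfolding x(2)[symmetric] by (rule assoc_mult_mat_vec[OF I(1) H x(1)])
      also have "\<dots> = 0\<^sub>v (N + N)" using I(1) by (intro eq_vecI) auto
      finally show "x = 0\<^sub>v (N + N)" .
    qed (use A B_sa K in auto)
    obtain S T ps where S: "S \<in> Omega N" and T: "T \<in> carrier_mat (N + N) (N + N)"
      and ps: "\<forall>(k, l) \<in> set ps. k \<ge> 1 \<and> l < 0" and ST: "S * T = 1\<^sub>m (N + N)" "T * S = 1\<^sub>m (N + N)"
      and BS: "Bt * S = S * diag2 (D_mat ps) (D_mat ps)"
      and HS: "mat_adjoint S * Ht * S = diag2 (Qs_mat ps) (Qs_mat ps)"
      using canonical_form by blast
    note Sc = Omega_carrier[OF S]
    have inv: "invertible_mat S" using Sc T ST unfolding invertible_mat_def inverts_mat_def by auto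
    note J = invertible_mat_inverse[OF Sc inv]
    \<comment> \<open>The size is recovered from the number of columns in \<open>BS\<close>.\<close>
    have dc: "diag2 (D_mat ps) (D_mat ps) \<in> carrier_mat (N + N) (N + N)"
    proof -
      have e: "diag2 (D_mat ps) (D_mat ps) \<in> carrier_mat (bsize ps + bsize ps) (bsize ps + bsize ps)" by simp
      have "dim_col (Bt * S) = dim_col (diag2 (D_mat ps) (D_mat ps))" unfolding BS by simp
      hence "bsize ps + bsize ps = N + N" using e Sc by simp
      thus ?thesis using e by simp
    qed
    have "inv_mat S * Bt * S = inv_mat S * (S * diag2 (D_mat ps) (D_mat ps))"
      unfolding BS[symmetric] by (rule assoc_mult_mat[OF J(1) B Sc])
    also have "\<dots> = diag2 (D_mat ps) (D_mat ps)"
      unfolding assoc_mult_mat[OF J(1) Sc dc, symmetric] J(3) using dc by simp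
    finally show ?canonical using S inv ps HS unfolding dg by blast
  next
    assume ?canonical
    then obtain S ps where S: "S \<in> Omega N" "invertible_mat S"
      "inv_mat S * Bt * S = diag2 (D_mat ps) (D_mat ps)"
      "mat_adjoint S * Ht * S = diag2 (Qs_mat ps) (Qs_mat ps)" unfolding dg by blast
    note J = invertible_mat_inverse[OF Omega_carrier[OF S(1)] S(2)]
    show ?structure by (rule complex_structure_of_canonical_form[OF S(1) J B H S(3,4)])
  qed
  finally show ?thesis unfolding N_def .
qed

end
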